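(* Let $V$ be a $v$-dimensional vector space over $\mathrm{GF}(q)$, let $\{\mathbf 0\}=U_0<U_1<\dots<U_v=V$ be a maximal chain of subspaces of $V$, $k\in\{0,\dots,v\}$ and $s\in\{0,\dots,k-1\}$. Then the set of $k$-dimensional subspaces of $V$ is the disjoint union \[\genfrac{[}{]}{0pt}{}{V}{k}_q=\bigcup_{i=0}^{v-k}\genfrac{[}{]}{0pt}{}{U_{v-s-i-1}}{k-s-1}_q *_{U_{v-s-i}/U_{v-s-i-1}}\genfrac{[}{]}{0pt}{}{V/U_{v-s-i}}{s}_q,\] and consequently \[\begin{bmatrix} v\\ k\end{bmatrix}_q=\sum_{i=0}^{v-k} q^{(v-k-i)(s+1)}\begin{bmatrix} v-s-i-1\\ k-s-1\end{bmatrix}_q\begin{bmatrix} s+i\\ s\end{bmatrix}_q.\]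
   Context: $\genfrac{[}{]}{0pt}{}{W}{j}_q$ denotes the set of $j$-dimensional subspaces of a $\mathrm{GF}(q)$-vector space $W$, and $\begin{bmatrix} a\\ b\end{bmatrix}_q$ its size (Gaussian binomial coefficient). For $U_1\le U_2\le V$, a subspace $K\le V$ covers the factor $U_2/U_1$ if $U_1+K=U_2+K$. For $K_1\le U_1$ and $U_2\le K_2\le V$, the covering join is $K_1 *_{U_2/U_1} K_2/U_2=\{K\le V: U_1\cap K=K_1,\ U_2+K=K_2,\ K\text{ covers }U_2/U_1\}$. For a set $\mathcal{B}^{(1)}$ of subspaces of $U_1$ and a set $\mathcal{B}^{(2)}$ of subspaces of $V/U_2$, $\mathcal{B}^{(1)} *_{U_2/U_1}\mathcal{B}^{(2)}$ is the union of $B^{(1)} *_{U_2/U_1} K_2/U_2$ over all $B^{(1)}\in\mathcal{B}^{(1)}$ and all $K_2\ge U_2$ with $K_2/U_2\in\mathcal{B}^{(2)}$ (empty if either set is empty). *)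

theory Defs
  imports "HOL-Algebra.AbelCoset" "Jordan_Normal_Form.Missing_VectorSpace"
begin

text \<open>
  Vector spaces are the explicit-carrier ones of \<^locale>\<open>vectorspace\<close>; a subspace \<open>W\<close> of \<open>V\<close>,
  regarded as a vector space itself, is \<open>V\<lparr>carrier := W\<rparr>\<close>.
\<close>

definition subspaces_of_dim ::
  "('a, 'm) ring_scheme \<Rightarrow> ('a, 'c, 'd) module_scheme \<Rightarrow> nat \<Rightarrow> 'c set set"
  where "subspaces_of_dim K W j =
    {S. VectorSpace.subspace K S W \<and> vectorspace.fin_dim K (W\<lparr>carrier := S\<rparr>)
        \<and> vectorspace.dim K (W\<lparr>carrier := S\<rparr>) = j}"

text \<open>
  The size of the set of \<open>b\<close>-dimensional subspaces of an \<open>a\<close>-dimensional space over \<open>K\<close>,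
  taken on the coordinate space of functions from \<open>{..<a}\<close> to \<open>K\<close>.
\<close>

definition gaussian_binomial :: "('a, 'm) ring_scheme \<Rightarrow> nat \<Rightarrow> nat \<Rightarrow> nat"
  where "gaussian_binomial K a b = card (subspaces_of_dim K (ring.func_space K {..<a}) b)"

text \<open>
  The elements of \<open>V/U\<close> are the additive cosets of \<open>U\<close>. The ring multiplication and unit, which the
  record type requires, carry no meaning for a module. In \<open>smult\<close> the coset is formed after scaling,
  because \<open>{a \<odot>\<^bsub>V\<^esub> x |x. x \<in> A}\<close> is not a coset for \<open>a = \<zero>\<^bsub>K\<^esub>\<close> (unless \<open>U\<close> is trivial).
\<close>

definition quotient_space ::
  "('a, 'c, 'd) module_scheme \<Rightarrow> 'c set \<Rightarrow> ('a, 'c set) module"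
  where "quotient_space V U =
    \<lparr>carrier = a_rcosets\<^bsub>V\<^esub> U, mult = (\<lambda>A B. U), one = U, zero = U, add = set_add V,
     smult = (\<lambda>a A. \<Union>x\<in>A. U +>\<^bsub>V\<^esub> (a \<odot>\<^bsub>V\<^esub> x))\<rparr>"

definition covers :: "('a, 'c, 'd) module_scheme \<Rightarrow> 'c set \<Rightarrow> 'c set \<Rightarrow> 'c set \<Rightarrow> bool"
  where "covers V U1 U2 L \<longleftrightarrow> U1 <+>\<^bsub>V\<^esub> L = U2 <+>\<^bsub>V\<^esub> L"

text \<open>
  \<open>covering_join K V U1 U2 K1 K2\<close> is \<open>K1 *\<^bsub>U2/U1\<^esub> K2/U2\<close>: the quotient \<open>K2/U2\<close> is given by \<open>K2\<close>.
\<close>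

definition covering_join ::
  "('a, 'm) ring_scheme \<Rightarrow> ('a, 'c, 'd) module_scheme \<Rightarrow> 'c set \<Rightarrow> 'c set \<Rightarrow> 'c set \<Rightarrow> 'c set
    \<Rightarrow> 'c set set"
  where "covering_join K V U1 U2 K1 K2 =
    {L. VectorSpace.subspace K L V \<and> U1 \<inter> L = K1 \<and> U2 <+>\<^bsub>V\<^esub> L = K2 \<and> covers V U1 U2 L}"

definition covering_join_sets ::
  "('a, 'm) ring_scheme \<Rightarrow> ('a, 'c, 'd) module_scheme \<Rightarrow> 'c set \<Rightarrow> 'c set \<Rightarrow> 'c set set
    \<Rightarrow> 'c set set set \<Rightarrow> 'c set set"
  where "covering_join_sets K V U1 U2 \<B>1 \<B>2 =
    (\<Union>K1\<in>\<B>1. \<Union>K2\<in>{K2. VectorSpace.subspace K K2 V \<and> U2 \<subseteq> K2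
          \<and> carrier (quotient_space (V\<lparr>carrier := K2\<rparr>) U2) \<in> \<B>2}.
       covering_join K V U1 U2 K1 K2)"

definition maximal_subspace_chain ::
  "('a, 'm) ring_scheme \<Rightarrow> ('a, 'c, 'd) module_scheme \<Rightarrow> nat \<Rightarrow> (nat \<Rightarrow> 'c set) \<Rightarrow> bool"
  where "maximal_subspace_chain K V v U \<longleftrightarrow>
    U 0 = {\<zero>\<^bsub>V\<^esub>} \<and> U v = carrier V \<and> (\<forall>i<v. U i \<subset> U (Suc i))
    \<and> subset.maxchain {W. VectorSpace.subspace K W V} (U ` {..v})"

end

theory Submission
  imports Defs
begin

text \<open>
  Over a field with \<open>q\<close> elements a subspace has dimension \<open>j\<close> iff it has \<open>q\<^sup>j\<close> elements, so all
  dimension arguments become statements about cardinalities, the basic one being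
  \<open>|A + B| |A \<inter> B| = |A| |B|\<close>.

  For a \<open>k\<close>-dimensional \<open>L\<close> the numbers \<open>dim (U\<^sub>j \<inter> L)\<close> grow from \<open>0\<close> to \<open>k\<close> in steps of at most one,
  hence there is exactly one \<open>j\<close> at which they jump from \<open>k - s - 1\<close> to \<open>k - s\<close>. At this \<open>j\<close> the
  subspace \<open>L\<close> covers \<open>U\<^bsub>j+1\<^esub> / U\<^sub>j\<close>, which puts it into the summand with \<open>j = v - s - i - 1\<close>, and
  into no other one.

  In a covering join \<open>U\<^sub>2 + L = K\<^sub>2\<close> may be replaced by \<open>U\<^sub>1 + L = K\<^sub>2\<close>. The \<open>L\<close> with \<open>U\<^sub>1 \<inter> L = K\<^sub>1\<close> and
  \<open>U\<^sub>1 + L = K\<^sub>2\<close> are counted by induction on \<open>dim (K\<^sub>2 / U\<^sub>1)\<close>: for a hyperplane \<open>H\<close> of \<open>K\<^sub>2\<close>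
  containing \<open>U\<^sub>1\<close>, each intersection \<open>L \<inter> H\<close> extends to \<open>L\<close> in \<open>|H| / |L \<inter> H|\<close> ways. The same
  extension count yields a Pascal recurrence showing that the number of \<open>k\<close>-dimensional subspaces
  depends on the dimension only, which identifies it with the Gaussian binomial coefficient of the
  coordinate space.
\<close>

section \<open>Cancellation laws for differences in an abelian group\<close>

context abelian_group
begin

lemma diff_add_cancel: "a \<in> carrier G \<Longrightarrow> t \<in> carrier G \<Longrightarrow> (t \<ominus> a) \<oplus> a = t"
  by (simp add: a_minus_def a_assoc l_neg)

lemma add_diff_inverse: "a \<in> carrier G \<Longrightarrow> t \<in> carrier G \<Longrightarrow> a \<oplus> (t \<ominus> a) = t"
  by (metis diff_add_cancel a_comm minus_closed)

lemma add_diff_cancel_left: "a \<in> carrier G \<Longrightarrow> t \<in> carrier G \<Longrightarrow> (a \<oplus> t) \<ominus> a = t"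
  by (metis a_comm a_minus_def a_assoc a_inv_closed r_neg r_zero)

lemma diff_diff_cancel: "b \<in> carrier G \<Longrightarrow> y \<in> carrier G \<Longrightarrow> b \<ominus> (b \<ominus> y) = y"
  by (metis add_diff_cancel_left diff_add_cancel minus_closed)

lemma add_add_diff: "a \<in> carrier G \<Longrightarrow> b \<in> carrier G \<Longrightarrow> t \<in> carrier G \<Longrightarrow> (a \<oplus> t) \<oplus> (b \<ominus> t) = a \<oplus> b"
  by (metis a_assoc add_diff_inverse minus_closed)

text \<open>Two decompositions of one vector differ by a common shift, which therefore lies in both
  summands when these are subspaces.\<close>

lemma add_eq_imp_diff_eq:
  assumes "x \<in> carrier G" "y \<in> carrier G" "a \<in> carrier G" "b \<in> carrier G" "x \<oplus> y = a \<oplus> b"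
  shows "b \<ominus> y = x \<ominus> a"
proof -
  have "x = (a \<oplus> b) \<ominus> y"
    using add_diff_cancel_left[of y x] assms a_comm[of x y] by simp
  also have "\<dots> = a \<oplus> (b \<ominus> y)"
    using assms by (simp add: a_minus_def a_assoc)
  finally show ?thesis
    using add_diff_cancel_left[of a "b \<ominus> y"] assms by simp
qed

end

section \<open>Subspaces of a finite vector space, their sums and intersections\<close>

locale finite_vectorspace = vectorspace K V
  for K :: "('a, 'm) ring_scheme" and V :: "('a, 'c, 'd) module_scheme" +
  assumes finite_scalars: "finite (carrier K)"
    and finite_vectors: "finite (carrier V)"
begin

lemma subspaceI:
  assumes "S \<subseteq> carrier V" "\<zero>\<^bsub>V\<^esub> \<in> S"
    and "\<And>x y. x \<in> S \<Longrightarrow> y \<in> S \<Longrightarrow> x \<oplus>\<^bsub>V\<^esub> y \<in> S"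
    and "\<And>a x. a \<in> carrier K \<Longrightarrow> x \<in> S \<Longrightarrow> a \<odot>\<^bsub>V\<^esub> x \<in> S"
  shows "subspace K S V"
  unfolding subspace_def submodule_def
  using assms vectorspace_axioms module_axioms by blast

lemma
  assumes "subspace K S V"
  shows subspace_subset: "S \<subseteq> carrier V"
    and subspace_zero: "\<zero>\<^bsub>V\<^esub> \<in> S"
    and subspace_add: "\<And>x y. x \<in> S \<Longrightarrow> y \<in> S \<Longrightarrow> x \<oplus>\<^bsub>V\<^esub> y \<in> S"
    and subspace_smult: "\<And>a x. a \<in> carrier K \<Longrightarrow> x \<in> S \<Longrightarrow> a \<odot>\<^bsub>V\<^esub> x \<in> S"
  using assms unfolding subspace_def submodule_def by blast+

lemma subspace_neg: "subspace K S V \<Longrightarrow> x \<in> S \<Longrightarrow> \<ominus>\<^bsub>V\<^esub> x \<in> S"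
  using subspace_smult[of S "\<ominus>\<^bsub>K\<^esub> \<one>\<^bsub>K\<^esub>" x] subspace_subset[of S] smult_minus_1[of x] by auto

lemma subspace_diff: "subspace K S V \<Longrightarrow> x \<in> S \<Longrightarrow> y \<in> S \<Longrightarrow> x \<ominus>\<^bsub>V\<^esub> y \<in> S"
  by (simp add: a_minus_def subspace_add subspace_neg)

lemma subspace_finite: "subspace K S V \<Longrightarrow> finite S"
  using subspace_subset finite_vectors finite_subset by blast

lemma subspace_card_pos: "subspace K S V \<Longrightarrow> card S > 0"
  using subspace_finite subspace_zero card_gt_0_iff by blast

lemma subspace_carrier: "subspace K (carrier V) V"
  by (rule subspaceI) auto

lemma subspace_trivial: "subspace K {\<zero>\<^bsub>V\<^esub>} V"
  by (rule subspaceI) auto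

lemma subspace_inter: "subspace K A V \<Longrightarrow> subspace K B V \<Longrightarrow> subspace K (A \<inter> B) V"
  by (rule subspaceI) (auto simp: subspace_zero subspace_add subspace_smult dest: subspace_subset)

lemma subspace_mem_carrier: "subspace K S V \<Longrightarrow> x \<in> S \<Longrightarrow> x \<in> carrier V"
  using subspace_subset by blast

lemma set_add_iff: "z \<in> A <+>\<^bsub>V\<^esub> B \<longleftrightarrow> (\<exists>a\<in>A. \<exists>b\<in>B. z = a \<oplus>\<^bsub>V\<^esub> b)"
  by (auto simp: set_add_def')

lemma subspace_set_add:
  assumes A: "subspace K A V" and B: "subspace K B V"
  shows "subspace K (A <+>\<^bsub>V\<^esub> B) V"
proof -
  have "A <+>\<^bsub>V\<^esub> B = subspace_sum A B"
    by (rule Set.set_eqI) (fastforce simp: set_add_iff submodule_sum_def image_iff)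
  then show ?thesis
    using sum_is_subspace[OF A B] by simp
qed

lemma set_add_upper1: "subspace K A V \<Longrightarrow> subspace K B V \<Longrightarrow> A \<subseteq> A <+>\<^bsub>V\<^esub> B"
  using subspace_zero[of B] M.r_zero subspace_mem_carrier[of A]
  by (metis set_add_iff subsetI)

lemma set_add_upper2: "subspace K A V \<Longrightarrow> subspace K B V \<Longrightarrow> B \<subseteq> A <+>\<^bsub>V\<^esub> B"
  using subspace_zero[of A] M.l_zero subspace_mem_carrier[of B]
  by (metis set_add_iff subsetI)

lemma set_add_least: "subspace K C V \<Longrightarrow> A \<subseteq> C \<Longrightarrow> B \<subseteq> C \<Longrightarrow> A <+>\<^bsub>V\<^esub> B \<subseteq> C"
  using subspace_add[of C] by (fastforce simp: set_add_iff)

text \<open>Addition maps \<open>A \<times> B\<close> onto the sum. Once a preimage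
  \<open>(a, b)\<close> of \<open>z\<close> is fixed, the others are \<open>(a + t, b - t)\<close>
  with \<open>t\<close> in \<open>A \<inter> B\<close>, so all fibres have the same size. This is
  the dimension formula in multiplicative form.\<close>

lemma card_set_add:
  assumes A: "subspace K A V" and B: "subspace K B V"
  shows "card (A <+>\<^bsub>V\<^esub> B) * card (A \<inter> B) = card A * card B"
proof -
  have cA: "\<And>x. x \<in> A \<Longrightarrow> x \<in> carrier V" and cB: "\<And>x. x \<in> B \<Longrightarrow> x \<in> carrier V"
    using A B subspace_mem_carrier by blast+
  let ?f = "\<lambda>(a, b). a \<oplus>\<^bsub>V\<^esub> b"
  have img: "?f ` (A \<times> B) = A <+>\<^bsub>V\<^esub> B"
    by (rule Set.set_eqI) (fastforce simp: set_add_iff image_iff)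
  have fin: "finite (A \<times> B)"
    using A B subspace_finite by blast
  have fib: "card {p \<in> A \<times> B. ?f p = z} = card (A \<inter> B)" if zAB: "z \<in> A <+>\<^bsub>V\<^esub> B" for z
  proof -
    obtain a b where ab: "a \<in> A" "b \<in> B" and z: "z = a \<oplus>\<^bsub>V\<^esub> b"
      using zAB unfolding set_add_iff by blast
    note car = cA[OF ab(1)] cB[OF ab(2)]
    have "bij_betw (\<lambda>t. (a \<oplus>\<^bsub>V\<^esub> t, b \<ominus>\<^bsub>V\<^esub> t)) (A \<inter> B) {p \<in> A \<times> B. ?f p = z}"
    \<comment> \<open>The shift \<open>t\<close> is recovered from the first component by
      subtracting \<open>a\<close>.\<close>
    proof (rule bij_betwI[where g = "\<lambda>p. fst p \<ominus>\<^bsub>V\<^esub> a"])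
      show "(\<lambda>t. (a \<oplus>\<^bsub>V\<^esub> t, b \<ominus>\<^bsub>V\<^esub> t)) \<in> A \<inter> B \<rightarrow> {p \<in> A \<times> B. ?f p = z}"
        using subspace_add[OF A ab(1)] subspace_diff[OF B ab(2)] M.add_add_diff[OF car cA]
        by (simp add: z Pi_iff)
      show "(a \<oplus>\<^bsub>V\<^esub> (fst p \<ominus>\<^bsub>V\<^esub> a), b \<ominus>\<^bsub>V\<^esub> (fst p \<ominus>\<^bsub>V\<^esub> a)) = p"
        if p: "p \<in> {p \<in> A \<times> B. ?f p = z}" for p
      proof -
        obtain x y where xy: "p = (x, y)" "x \<in> A" "y \<in> B" "x \<oplus>\<^bsub>V\<^esub> y = a \<oplus>\<^bsub>V\<^esub> b"
          using p z by auto
        then have "b \<ominus>\<^bsub>V\<^esub> (x \<ominus>\<^bsub>V\<^esub> a) = y"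
          using M.add_eq_imp_diff_eq[OF cA cB car xy(4)] M.diff_diff_cancel[OF car(2) cB] by metis
        then show ?thesis
          using xy M.add_diff_inverse[OF car(1) cA] by simp
      qed
      show "(\<lambda>p. fst p \<ominus>\<^bsub>V\<^esub> a) \<in> {p \<in> A \<times> B. ?f p = z} \<rightarrow> A \<inter> B"
      proof
        fix p assume "p \<in> {p \<in> A \<times> B. ?f p = z}"
        then obtain x y where xy: "p = (x, y)" "x \<in> A" "y \<in> B" "x \<oplus>\<^bsub>V\<^esub> y = a \<oplus>\<^bsub>V\<^esub> b"
          using z by auto
        then have "b \<ominus>\<^bsub>V\<^esub> y = x \<ominus>\<^bsub>V\<^esub> a"
          using M.add_eq_imp_diff_eq[OF cA cB car] by blast
        then show "fst p \<ominus>\<^bsub>V\<^esub> a \<in> A \<inter> B"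
          using subspace_diff[OF A xy(2) ab(1)] subspace_diff[OF B ab(2) xy(3)] xy(1) by simp
      qed
      show "fst (a \<oplus>\<^bsub>V\<^esub> t, b \<ominus>\<^bsub>V\<^esub> t) \<ominus>\<^bsub>V\<^esub> a = t" if "t \<in> A \<inter> B" for t
        using that M.add_diff_cancel_left[OF car(1) cA] by simp
    qed
    then show ?thesis
      by (rule bij_betw_same_card[symmetric])
  qed
  have "card A * card B = card (A \<times> B)"
    by (simp add: card_cartesian_product)
  also have "\<dots> = (\<Sum>p\<in>A \<times> B. 1)"
    by simp
  also have "\<dots> = (\<Sum>z\<in>?f ` (A \<times> B). \<Sum>p\<in>{p \<in> A \<times> B. ?f p = z}. 1)"
    by (rule sum.image_gen[OF fin])
  also have "\<dots> = (\<Sum>z\<in>A <+>\<^bsub>V\<^esub> B. card (A \<inter> B))"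
    unfolding img by (rule sum.cong) (use fib in auto)
  finally show ?thesis
    by simp
qed

section \<open>Powers of the field order, lines and hyperplanes\<close>

abbreviation "q \<equiv> order K"

lemma order_ge_2: "q \<ge> 2"
proof -
  have "{\<zero>\<^bsub>K\<^esub>, \<one>\<^bsub>K\<^esub>} \<subseteq> carrier K" "card {\<zero>\<^bsub>K\<^esub>, \<one>\<^bsub>K\<^esub>} = 2"
    by auto
  then show ?thesis
    unfolding order_def using card_mono[OF finite_scalars] by metis
qed

text \<open>As simplification rules, this and the next lemma turn comparisons of sizes of subspaces
  into comparisons of dimensions.\<close>

lemma power_order_inject [simp]: "q ^ m = q ^ n \<longleftrightarrow> m = n"
  using order_ge_2 by (simp add: power_inject_exp)

lemma power_order_le_iff [simp]: "q ^ m \<le> q ^ n \<longleftrightarrow> m \<le> n"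
  using order_ge_2 by (simp add: power_increasing_iff)

definition line :: "'c \<Rightarrow> 'c set"
  where "line x = {a \<odot>\<^bsub>V\<^esub> x | a. a \<in> carrier K}"

lemma subspace_line: "x \<in> carrier V \<Longrightarrow> subspace K (line x) V"
proof (rule subspaceI)
  assume x: "x \<in> carrier V"
  show "line x \<subseteq> carrier V"
    using x by (auto simp: line_def)
  show "\<zero>\<^bsub>V\<^esub> \<in> line x"
    using x lmult_0[OF x] unfolding line_def by force
  show "y \<oplus>\<^bsub>V\<^esub> z \<in> line x" if "y \<in> line x" "z \<in> line x" for y z
    using that x unfolding line_def by (auto simp: smult_l_distr[symmetric])
  show "a \<odot>\<^bsub>V\<^esub> y \<in> line x" if "a \<in> carrier K" "y \<in> line x" for a y
    using that x unfolding line_def by (auto simp: smult_assoc1[symmetric])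
qed

lemma mem_line: "x \<in> carrier V \<Longrightarrow> x \<in> line x"
  unfolding line_def using smult_one[of x] by force

lemma line_subset: "subspace K S V \<Longrightarrow> x \<in> S \<Longrightarrow> line x \<subseteq> S"
  by (auto simp: line_def subspace_smult)

lemma smult_mem_subspace_iff:
  assumes S: "subspace K S V" and x: "x \<in> carrier V" and a: "a \<in> carrier K" "a \<odot>\<^bsub>V\<^esub> x \<in> S"
    and a0: "a \<noteq> \<zero>\<^bsub>K\<^esub>"
  shows "x \<in> S"
  using mult_inverse[OF a(1) x refl a0] subspace_smult[OF S _ a(2)] a a0 inverse_exists by metis

lemma inter_line:
  assumes S: "subspace K S V" and x: "x \<in> carrier V" "x \<notin> S"
  shows "S \<inter> line x = {\<zero>\<^bsub>V\<^esub>}"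
proof
  show "S \<inter> line x \<subseteq> {\<zero>\<^bsub>V\<^esub>}"
    using smult_mem_subspace_iff[OF S x(1)] x lmult_0[OF x(1)] unfolding line_def by blast
  show "{\<zero>\<^bsub>V\<^esub>} \<subseteq> S \<inter> line x"
    using subspace_zero[OF S] subspace_zero[OF subspace_line[OF x(1)]] by blast
qed

lemma card_line:
  assumes x: "x \<in> carrier V" "x \<noteq> \<zero>\<^bsub>V\<^esub>"
  shows "card (line x) = q"
proof -
  have "inj_on (\<lambda>a. a \<odot>\<^bsub>V\<^esub> x) (carrier K)"
  \<comment> \<open>If \<open>a\<close> and \<open>b\<close> differ but give the same multiple of
    \<open>x\<close>, then the nonzero scalar \<open>a - b\<close> sends \<open>x\<close> into the
    zero subspace, which forces \<open>x\<close> to vanish.\<close>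
  proof (rule inj_onI, rule ccontr)
    fix a b assume ab: "a \<in> carrier K" "b \<in> carrier K" "a \<odot>\<^bsub>V\<^esub> x = b \<odot>\<^bsub>V\<^esub> x" "a \<noteq> b"
    have "(a \<ominus>\<^bsub>K\<^esub> b) \<odot>\<^bsub>V\<^esub> x = (b \<oplus>\<^bsub>K\<^esub> \<ominus>\<^bsub>K\<^esub> b) \<odot>\<^bsub>V\<^esub> x"
      unfolding a_minus_def using ab x by (simp add: smult_l_distr del: R.r_neg)
    also have "\<dots> = \<zero>\<^bsub>V\<^esub>"
      using ab x by (simp add: R.r_neg)
    finally have "(a \<ominus>\<^bsub>K\<^esub> b) \<odot>\<^bsub>V\<^esub> x \<in> {\<zero>\<^bsub>V\<^esub>}"
      by simp
    moreover have "a \<ominus>\<^bsub>K\<^esub> b \<noteq> \<zero>\<^bsub>K\<^esub>"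
      using ab by simp
    ultimately have "x \<in> {\<zero>\<^bsub>V\<^esub>}"
      using smult_mem_subspace_iff[OF subspace_trivial x(1), of "a \<ominus>\<^bsub>K\<^esub> b"] ab by auto
    then show False
      using x by simp
  qed
  moreover have "line x = (\<lambda>a. a \<odot>\<^bsub>V\<^esub> x) ` carrier K"
    by (auto simp: line_def)
  ultimately show ?thesis
    by (simp add: card_image order_def)
qed

lemma card_add_line:
  assumes S: "subspace K S V" and x: "x \<in> carrier V" "x \<notin> S"
  shows "card (S <+>\<^bsub>V\<^esub> line x) = q * card S"
proof -
  have "x \<noteq> \<zero>\<^bsub>V\<^esub>"
    using x subspace_zero[OF S] by auto
  then show ?thesis
    using card_set_add[OF S subspace_line[OF x(1)]] inter_line[OF S x] card_line[OF x(1)] by simp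
qed

text \<open>A subspace maximal among those that contain \<open>U\<close> and lie strictly inside
  \<open>W\<close> works: adding the line through a vector of \<open>W\<close> outside it gives all
  of \<open>W\<close> by maximality, and multiplies the size by \<open>q\<close>.\<close>

lemma hyperplane_exists:
  assumes U: "subspace K U V" and W: "subspace K W V" and UW: "U \<subset> W"
  obtains H where "subspace K H V" "U \<subseteq> H" "H \<subset> W" "card W = q * card H"
proof -
  define C where "C = {H. subspace K H V \<and> U \<subseteq> H \<and> H \<subset> W}"
  have "C \<subseteq> Pow W"
    by (auto simp: C_def)
  then have "finite C"
    using subspace_finite[OF W] finite_Pow_iff finite_subset by metis
  moreover have "U \<in> C"
    using U UW by (simp add: C_def)
  ultimately obtain H where H: "H \<in> C" and max: "\<And>H'. H' \<in> C \<Longrightarrow> H \<subseteq> H' \<Longrightarrow> H = H'"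
    using finite_has_maximal[of C] by (metis empty_iff)
  then have HV: "subspace K H V" and UH: "U \<subseteq> H" and HW: "H \<subset> W"
    by (simp_all add: C_def)
  obtain x where x: "x \<in> W" "x \<notin> H"
    using HW by blast
  have xV: "x \<in> carrier V"
    using x W subspace_mem_carrier by blast
  define H' where "H' = H <+>\<^bsub>V\<^esub> line x"
  have sub: "subspace K H' V" and up: "H \<subseteq> H'" "line x \<subseteq> H'"
    unfolding H'_def using subspace_set_add[OF HV subspace_line[OF xV]]
      set_add_upper1[OF HV subspace_line[OF xV]] set_add_upper2[OF HV subspace_line[OF xV]]
    by blast+
  have le: "H' \<subseteq> W"
    unfolding H'_def using set_add_least[OF W _ line_subset[OF W x(1)]] HW by blast
  have "H' = W"
  proof (rule ccontr)
    assume "H' \<noteq> W"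
    then have "H' \<in> C"
      using sub le up UH by (auto simp: C_def)
    then have "H = H'"
      using max up by blast
    then show False
      using up mem_line[OF xV] x by blast
  qed
  then have "card W = q * card H"
    using card_add_line[OF HV xV x(2)] by (simp add: H'_def)
  then show thesis
    using that[OF HV UH HW] by blast
qed

end

section \<open>Relative complements\<close>

context finite_vectorspace
begin

text \<open>For \<open>K1 \<subseteq> U \<subseteq> W\<close> these are the complements of
  \<open>U\<close> in the interval from \<open>K1\<close> to \<open>W\<close> of the subspace
  lattice.\<close>

definition joins :: "'c set \<Rightarrow> 'c set \<Rightarrow> 'c set \<Rightarrow> 'c set set"
  where "joins U K1 W = {L. subspace K L V \<and> U \<inter> L = K1 \<and> U <+>\<^bsub>V\<^esub> L = W}"

lemma finite_joins: "finite (joins U K1 W)"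
proof (rule finite_subset)
  show "joins U K1 W \<subseteq> Pow (carrier V)"
    using subspace_subset by (auto simp: joins_def)
  show "finite (Pow (carrier V))"
    using finite_vectors by simp
qed

lemma card_joins_mem:
  assumes "subspace K U V" "L \<in> joins U K1 W"
  shows "card W * card K1 = card U * card L"
  using card_set_add[of U L] assms by (simp add: joins_def)

lemma subspace_eqI_card:
  assumes "subspace K A V" "A \<subseteq> B" "subspace K B V" "card A = card B"
  shows "A = B"
  using card_subset_eq[OF subspace_finite] assms by blast

lemma hyperplane_add_line:
  assumes H: "subspace K H V" and W: "subspace K W V" and HW: "H \<subseteq> W" "card W = q * card H"
    and x: "x \<in> W" "x \<notin> H"
  shows "H <+>\<^bsub>V\<^esub> line x = W"
proof -
  have xV: "x \<in> carrier V"
    using W x subspace_mem_carrier by blast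
  show ?thesis
  proof (rule subspace_eqI_card)
    show "subspace K (H <+>\<^bsub>V\<^esub> line x) V"
      by (rule subspace_set_add[OF H subspace_line[OF xV]])
    show "H <+>\<^bsub>V\<^esub> line x \<subseteq> W"
      by (rule set_add_least[OF W HW(1) line_subset[OF W x(1)]])
    show "card (H <+>\<^bsub>V\<^esub> line x) = card W"
      using card_add_line[OF H xV x(2)] HW by simp
  qed (rule W)
qed

lemma joins_memD:
  assumes "subspace K U V" "L \<in> joins U K1 W"
  shows "subspace K L V" "K1 \<subseteq> L" "L \<subseteq> W" "U \<inter> L = K1" "U <+>\<^bsub>V\<^esub> L = W"
  using assms set_add_upper2[of U L] by (auto simp: joins_def)

text \<open>The vectors of \<open>W - H\<close> are counted twice. Each such \<open>x\<close> lies
  in exactly one join, namely \<open>L'\<close> plus the line through \<open>x\<close>, and each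
  join \<open>L\<close> contains \<open>|L| - |L'| = (q - 1) |L'|\<close> of them. Cancelling
  \<open>q - 1\<close> leaves the claim, stated as a product to avoid division.\<close>

lemma card_joins_hyperplane:
  assumes H: "subspace K H V" and W: "subspace K W V" and L': "subspace K L' V"
    and sub: "L' \<subseteq> H" "H \<subseteq> W" and card: "card W = q * card H"
  shows "card (joins H L' W) * card L' = card H"
proof -
  have Hpos: "0 < card H"
    by (rule subspace_card_pos[OF H])
  have cardL: "card L = q * card L'" if "L \<in> joins H L' W" for L
    using card_joins_mem[OF H that] card Hpos by simp
  \<comment> \<open>\<open>L'\<close> has index \<open>q\<close> in \<open>L\<close>, and
    \<open>x\<close> lies outside \<open>L'\<close> because it lies outside \<open>H\<close>; hence
    \<open>L'\<close> and \<open>x\<close> span \<open>L\<close>.\<close>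
  have unique: "L = L' <+>\<^bsub>V\<^esub> line x" if L: "L \<in> joins H L' W" and x: "x \<in> L - H" for L x
  proof -
    have "x \<notin> L'"
      using x sub by blast
    then show ?thesis
      using hyperplane_add_line[OF L' joins_memD(1,2)[OF H L] cardL[OF L]] x by simp
  qed
  have exists: "L' <+>\<^bsub>V\<^esub> line x \<in> joins H L' W" if x: "x \<in> W - H" for x
  proof -
    have xV: "x \<in> carrier V"
      using W x subspace_mem_carrier by blast
    note ln = subspace_line[OF xV]
    have sL: "subspace K (L' <+>\<^bsub>V\<^esub> line x) V"
      by (rule subspace_set_add[OF L' ln])
    \<comment> \<open>For \<open>y = l + z\<close> in \<open>H\<close>, the part \<open>z\<close> on
      the line is a difference of elements of \<open>H\<close>; the line meets \<open>H\<close> only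
      in zero, so \<open>y = l\<close>.\<close>
    have "H \<inter> (L' <+>\<^bsub>V\<^esub> line x) \<subseteq> L'"
    proof
      fix y assume y: "y \<in> H \<inter> (L' <+>\<^bsub>V\<^esub> line x)"
      then obtain l z where lz: "l \<in> L'" "z \<in> line x" "y = l \<oplus>\<^bsub>V\<^esub> z"
        by (auto simp: set_add_iff)
      have car: "l \<in> carrier V" "z \<in> carrier V"
        using lz subspace_mem_carrier[OF L'] subspace_mem_carrier[OF ln] by auto
      have "y \<ominus>\<^bsub>V\<^esub> l = z"
        unfolding lz(3) by (rule M.add_diff_cancel_left[OF car])
      moreover have "y \<ominus>\<^bsub>V\<^esub> l \<in> H"
        using subspace_diff[OF H] y lz sub by blast
      ultimately have "z \<in> H \<inter> line x"
        using lz by simp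
      then have "z = \<zero>\<^bsub>V\<^esub>"
        using inter_line[OF H xV] x by blast
      then show "y \<in> L'"
        using lz car by simp
    qed
    moreover have "L' \<subseteq> L' <+>\<^bsub>V\<^esub> line x"
      by (rule set_add_upper1[OF L' ln])
    ultimately have "H \<inter> (L' <+>\<^bsub>V\<^esub> line x) = L'"
      using sub by blast
    moreover have "H <+>\<^bsub>V\<^esub> (L' <+>\<^bsub>V\<^esub> line x) = W"
    proof
      show "H <+>\<^bsub>V\<^esub> (L' <+>\<^bsub>V\<^esub> line x) \<subseteq> W"
        using set_add_least[OF W, of H "L' <+>\<^bsub>V\<^esub> line x"] set_add_least[OF W, of L' "line x"]
          line_subset[OF W, of x] x sub by blast
      have "H <+>\<^bsub>V\<^esub> line x \<subseteq> H <+>\<^bsub>V\<^esub> (L' <+>\<^bsub>V\<^esub> line x)"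
        using set_add_least[OF subspace_set_add[OF H sL], of H "line x"]
          set_add_upper1[OF H sL] set_add_upper2[OF H sL] set_add_upper2[OF L' ln] by blast
      then show "W \<subseteq> H <+>\<^bsub>V\<^esub> (L' <+>\<^bsub>V\<^esub> line x)"
        using hyperplane_add_line[OF H W sub(2) card, of x] x by simp
    qed
    ultimately show ?thesis
      using sL by (simp add: joins_def)
  qed
  have part: "W - H = (\<Union>L\<in>joins H L' W. L - H)"
  proof
    show "W - H \<subseteq> (\<Union>L\<in>joins H L' W. L - H)"
    proof
      fix x assume x: "x \<in> W - H"
      then have "x \<in> carrier V"
        using W subspace_mem_carrier by blast
      then have "x \<in> L' <+>\<^bsub>V\<^esub> line x"
        using set_add_upper2[OF L' subspace_line] mem_line by blast
      then show "x \<in> (\<Union>L\<in>joins H L' W. L - H)"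
        using exists[OF x] x by blast
    qed
    show "(\<Union>L\<in>joins H L' W. L - H) \<subseteq> W - H"
      using joins_memD(3)[OF H] by blast
  qed
  have fin: "finite (L - H)" if "L \<in> joins H L' W" for L
    using subspace_finite[OF joins_memD(1)[OF H that]] by simp
  have disj: "(L1 - H) \<inter> (L2 - H) = {}"
    if "L1 \<in> joins H L' W" "L2 \<in> joins H L' W" "L1 \<noteq> L2" for L1 L2
    using unique[OF that(1)] unique[OF that(2)] that(3) by blast
  have cardLH: "card (L - H) = (q - 1) * card L'" if L: "L \<in> joins H L' W" for L
  proof -
    have "card (L - H) = card L - card (L \<inter> H)"
      by (rule card_Diff_subset_Int) (use subspace_finite[OF H] in simp)
    then show ?thesis
      using cardL[OF L] joins_memD(4)[OF H L] by (simp add: Int_commute diff_mult_distrib)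
  qed
  have "(q - 1) * card H = card W - card H"
    by (simp add: card diff_mult_distrib)
  also have "\<dots> = card (W - H)"
    by (rule card_Diff_subset[symmetric]) (use sub subspace_finite[OF H] in auto)
  also have "\<dots> = (\<Sum>L\<in>joins H L' W. card (L - H))"
    unfolding part by (rule card_UN_disjoint) (simp_all add: finite_joins fin disj)
  also have "\<dots> = card (joins H L' W) * ((q - 1) * card L')"
    using cardLH by simp
  finally have "(q - 1) * (card (joins H L' W) * card L') = (q - 1) * card H"
    by (auto simp: mult_ac)
  moreover have "0 < q - 1"
    using order_ge_2 by linarith
  ultimately show ?thesis
    by (metis mult_cancel1 less_numeral_extra(3))
qed

text \<open>A join in \<open>W\<close> is built in two stages through the intermediate space
  \<open>H\<close>: its trace \<open>H \<inter> L\<close> is a join in \<open>H\<close>, and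
  \<open>L\<close> is then a join of \<open>H\<close> over this trace.\<close>

lemma joins_split:
  assumes U: "subspace K U V" and H: "subspace K H V" and W: "subspace K W V"
    and sub: "U \<subseteq> H" "H \<subseteq> W"
  shows "joins U K1 W = (\<Union>L'\<in>joins U K1 H. joins H L' W)"
proof
  show "joins U K1 W \<subseteq> (\<Union>L'\<in>joins U K1 H. joins H L' W)"
  proof
    fix L assume L: "L \<in> joins U K1 W"
    note LD = joins_memD[OF U L]
    have sHL: "subspace K (H \<inter> L) V"
      by (rule subspace_inter[OF H LD(1)])
    \<comment> \<open>This is the modular law: if \<open>h = u + l\<close> lies in \<open>H\<close>
      and \<open>u\<close> lies in \<open>U \<subseteq> H\<close>, then \<open>l\<close> lies in
      \<open>H\<close> too.\<close>
    have "H \<subseteq> U <+>\<^bsub>V\<^esub> (H \<inter> L)"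
    proof
      fix h assume h: "h \<in> H"
      then have "h \<in> U <+>\<^bsub>V\<^esub> L"
        using LD(5) sub by blast
      then obtain u l where ul: "u \<in> U" "l \<in> L" "h = u \<oplus>\<^bsub>V\<^esub> l"
        unfolding set_add_iff by blast
      have "h \<ominus>\<^bsub>V\<^esub> u = l"
        unfolding ul(3)
        by (rule M.add_diff_cancel_left[OF subspace_mem_carrier[OF U ul(1)]
              subspace_mem_carrier[OF LD(1) ul(2)]])
      moreover have "h \<ominus>\<^bsub>V\<^esub> u \<in> H"
        using subspace_diff[OF H h] ul sub by blast
      ultimately have "l \<in> H \<inter> L"
        using ul by simp
      then show "h \<in> U <+>\<^bsub>V\<^esub> (H \<inter> L)"
        unfolding set_add_iff using ul by blast
    qed
    moreover have "U <+>\<^bsub>V\<^esub> (H \<inter> L) \<subseteq> H"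
      using set_add_least[OF H, of U "H \<inter> L"] sub by blast
    ultimately have "H \<inter> L \<in> joins U K1 H"
      using sHL LD(4) sub by (auto simp: joins_def)
    moreover have "L \<in> joins H (H \<inter> L) W"
    proof -
      have "U <+>\<^bsub>V\<^esub> L \<subseteq> H <+>\<^bsub>V\<^esub> L"
        using set_add_least[OF subspace_set_add[OF H LD(1)], of U L]
          set_add_upper1[OF H LD(1)] set_add_upper2[OF H LD(1)] sub by blast
      moreover have "H <+>\<^bsub>V\<^esub> L \<subseteq> W"
        by (rule set_add_least[OF W sub(2) LD(3)])
      ultimately show ?thesis
        using LD(1,5) by (simp add: joins_def)
    qed
    ultimately show "L \<in> (\<Union>L'\<in>joins U K1 H. joins H L' W)"
      by blast
  qed
  show "(\<Union>L'\<in>joins U K1 H. joins H L' W) \<subseteq> joins U K1 W"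
  proof clarify
    fix L' L assume L': "L' \<in> joins U K1 H" and L: "L \<in> joins H L' W"
    note LD' = joins_memD[OF U L'] and LD = joins_memD[OF H L]
    have UL: "subspace K (U <+>\<^bsub>V\<^esub> L) V"
      by (rule subspace_set_add[OF U LD(1)])
    have "U <+>\<^bsub>V\<^esub> L' \<subseteq> U <+>\<^bsub>V\<^esub> L"
      using set_add_least[OF UL, of U L'] set_add_upper1[OF U LD(1)] set_add_upper2[OF U LD(1)] LD(2)
      by blast
    then have "H <+>\<^bsub>V\<^esub> L \<subseteq> U <+>\<^bsub>V\<^esub> L"
      using set_add_least[OF UL, of H L] set_add_upper2[OF U LD(1)] LD'(5) by blast
    moreover have "U <+>\<^bsub>V\<^esub> L \<subseteq> W"
      using set_add_least[OF W, of U L] sub LD(3) by blast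
    ultimately have "U <+>\<^bsub>V\<^esub> L = W"
      using LD(5) by blast
    moreover have "U \<inter> L = K1"
      using LD(4) LD'(4) sub by blast
    ultimately show "L \<in> joins U K1 W"
      using LD(1) by (simp add: joins_def)
  qed
qed

text \<open>The union in \<open>joins_split\<close> is disjoint because \<open>L'\<close> is
  recovered from \<open>L\<close> as \<open>H \<inter> L\<close>.\<close>

lemma card_joins_split:
  assumes U: "subspace K U V" and H: "subspace K H V" and W: "subspace K W V"
    and sub: "U \<subseteq> H" "H \<subseteq> W"
  shows "card (joins U K1 W) = (\<Sum>L'\<in>joins U K1 H. card (joins H L' W))"
  unfolding joins_split[OF assms]
proof (rule card_UN_disjoint)
  show "\<forall>L1\<in>joins U K1 H. \<forall>L2\<in>joins U K1 H. L1 \<noteq> L2 \<longrightarrow> joins H L1 W \<inter> joins H L2 W = {}"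
    by (auto simp: joins_def)
qed (auto simp: finite_joins)

text \<open>Induction on the codimension \<open>m\<close> of \<open>U\<close> in \<open>W\<close>:
  by splitting at a hyperplane of \<open>W\<close> above \<open>U\<close>, each further dimension
  multiplies the number of joins by \<open>|U| / |K1|\<close>. The factor \<open>card K1 ^ m\<close>
  on the left clears this quotient.\<close>

lemma card_joins_mult:
  assumes U: "subspace K U V" and W: "subspace K W V" and K1: "subspace K K1 V"
    and sub: "K1 \<subseteq> U" "U \<subseteq> W" and card: "card W = q ^ m * card U"
  shows "card (joins U K1 W) * card K1 ^ m = card U ^ m"
  using W sub(2) card
proof (induction m arbitrary: W)
  case 0
  \<comment> \<open>In codimension zero every join lies inside \<open>U\<close>, hence equals
    \<open>U \<inter> L = K1\<close>.\<close>
  then have "W = U"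
    using subspace_eqI_card[OF U 0(2,1)] by simp
  have "joins U K1 W = {K1}"
  proof
    show "joins U K1 W \<subseteq> {K1}"
      using joins_memD[OF U] unfolding \<open>W = U\<close> by blast
    have "U <+>\<^bsub>V\<^esub> K1 = U"
      using set_add_least[OF U order_refl sub(1)] set_add_upper1[OF U K1] by blast
    then show "{K1} \<subseteq> joins U K1 W"
      using K1 sub(1) unfolding \<open>W = U\<close> by (auto simp: joins_def)
  qed
  then show ?case
    by simp
next
  case (Suc m)
  have "q ^ Suc m > 1"
    by (rule one_less_power) (use order_ge_2 in auto)
  then have "card U < card W"
    using Suc.prems(3) subspace_card_pos[OF U] by simp
  then have "U \<subset> W"
    using Suc.prems(2) by auto
  then obtain H where H: "subspace K H V" "U \<subseteq> H" "H \<subset> W" "card W = q * card H"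
    using hyperplane_exists[OF U Suc.prems(1)] by metis
  have cardH: "card H = q ^ m * card U"
    using H(4) Suc.prems(3) order_ge_2 by simp
  \<comment> \<open>There are \<open>|H| / |L'|\<close> extensions of \<open>L'\<close>, and the
    product formula for \<open>H = U + L'\<close> rewrites this ratio as \<open>|U| / |K1|\<close>,
    the same for every \<open>L'\<close>.\<close>
  have step: "card (joins H L' W) * card K1 = card U" if L': "L' \<in> joins U K1 H" for L'
  proof -
    note LD = joins_memD[OF U L']
    have "card H * (card (joins H L' W) * card K1) = card (joins H L' W) * (card U * card L')"
      using card_joins_mem[OF U L'] by (simp add: mult_ac)
    also have "\<dots> = card U * card H"
      using card_joins_hyperplane[OF H(1) Suc.prems(1) LD(1) LD(3) _ H(4)] H(3)
      by (simp add: mult_ac)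
    finally show ?thesis
      using subspace_card_pos[OF H(1)] by simp
  qed
  have "card (joins U K1 W) * card K1 ^ Suc m
      = (\<Sum>L'\<in>joins U K1 H. card (joins H L' W) * card K1) * card K1 ^ m"
    using card_joins_split[OF U H(1) Suc.prems(1) H(2), of K1] H(3)
    by (simp add: sum_distrib_right[symmetric])
  also have "\<dots> = card U * (card (joins U K1 H) * card K1 ^ m)"
    using step by simp
  also have "\<dots> = card U ^ Suc m"
    using Suc.IH[OF H(1,2) cardH] by simp
  finally show ?case .
qed

text \<open>Here \<open>a\<close> is the dimension of \<open>U / K1\<close> and \<open>m\<close>
  that of \<open>W / U\<close>; the count equals the number of linear maps from \<open>W / U\<close>
  to \<open>U / K1\<close>, as expected for complements.\<close>

lemma card_joins:
  assumes U: "subspace K U V" and W: "subspace K W V" and K1: "subspace K K1 V"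
    and sub: "K1 \<subseteq> U" "U \<subseteq> W" and card: "card W = q ^ m * card U" "card U = q ^ a * card K1"
  shows "card (joins U K1 W) = q ^ (a * m)"
proof -
  have "card (joins U K1 W) * card K1 ^ m = q ^ (a * m) * card K1 ^ m"
    using card_joins_mult[OF U W K1 sub card(1)] card(2) by (simp add: power_mult power_mult_distrib)
  then show ?thesis
    using subspace_card_pos[OF K1] by simp
qed

section \<open>Counting subspaces\<close>

text \<open>The dimension is encoded by the size, which fits the counting arguments;
  \<open>subspaces_of_dim_eq\<close> and \<open>subspaces_of_dim_subspace\<close> make the link with
  the actual dimension.\<close>

definition grassmannian :: "'c set \<Rightarrow> nat \<Rightarrow> 'c set set"
  where "grassmannian S k = {T. subspace K T V \<and> T \<subseteq> S \<and> card T = q ^ k}"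

lemma finite_grassmannian: "subspace K S V \<Longrightarrow> finite (grassmannian S k)"
  by (rule finite_subset[of _ "Pow S"]) (auto simp: grassmannian_def subspace_finite)

lemma grassmannian_0: "subspace K S V \<Longrightarrow> grassmannian S 0 = {{\<zero>\<^bsub>V\<^esub>}}"
  using subspace_zero subspace_trivial
  by (auto simp: grassmannian_def card_1_singleton_iff)

text \<open>A subspace of dimension \<open>k + 1\<close> either lies in \<open>H\<close>, or
  together with \<open>H\<close> spans \<open>S\<close> and then meets \<open>H\<close> in dimension
  \<open>k\<close>.\<close>

lemma grassmannian_hyperplane:
  assumes S: "subspace K S V" and H: "subspace K H V" "H \<subset> S" "card S = q * card H"
  shows "grassmannian S (Suc k)
    = grassmannian H (Suc k) \<union> (\<Union>L'\<in>grassmannian H k. joins H L' S)" (is "?l = ?r")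
proof
  have Hpos: "0 < card H"
    by (rule subspace_card_pos[OF H(1)])
  show "?l \<subseteq> ?r"
  proof
    fix L assume "L \<in> ?l"
    then have L: "subspace K L V" "L \<subseteq> S" "card L = q ^ Suc k"
      by (auto simp: grassmannian_def)
    show "L \<in> ?r"
    proof (cases "L \<subseteq> H")
      case True
      then show ?thesis
        using L by (simp add: grassmannian_def)
    next
      case False
      then obtain x where x: "x \<in> L" "x \<notin> H"
        by blast
      have "H <+>\<^bsub>V\<^esub> line x \<subseteq> H <+>\<^bsub>V\<^esub> L"
        using set_add_least[OF subspace_set_add[OF H(1) L(1)], of H "line x"]
          set_add_upper1[OF H(1) L(1)] set_add_upper2[OF H(1) L(1)] line_subset[OF L(1) x(1)]
        by blast
      moreover have "H <+>\<^bsub>V\<^esub> line x = S"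
        using hyperplane_add_line[OF H(1) S _ H(3) _ x(2)] H(2) L(2) x(1) by blast
      moreover have "H <+>\<^bsub>V\<^esub> L \<subseteq> S"
        using set_add_least[OF S, of H L] H(2) L(2) by blast
      ultimately have HL: "H <+>\<^bsub>V\<^esub> L = S"
        by blast
      then have "card (H \<inter> L) = q ^ k"
        using card_set_add[OF H(1) L(1)] H(3) L(3) Hpos order_ge_2 by simp
      then show ?thesis
        using HL subspace_inter[OF H(1) L(1)] L(1) by (auto simp: grassmannian_def joins_def)
    qed
  qed
  show "?r \<subseteq> ?l"
  proof (rule Un_least)
    show "grassmannian H (Suc k) \<subseteq> ?l"
      using H(2) by (auto simp: grassmannian_def)
    show "(\<Union>L'\<in>grassmannian H k. joins H L' S) \<subseteq> ?l"
    proof clarify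
      fix L' L assume L': "L' \<in> grassmannian H k" and L: "L \<in> joins H L' S"
      have "card L = q ^ Suc k"
        using card_joins_mem[OF H(1) L] H(3) L' Hpos by (simp add: grassmannian_def)
      then show "L \<in> ?l"
        using joins_memD[OF H(1) L] by (simp add: grassmannian_def)
    qed
  qed
qed

end

text \<open>
  For \<open>k > n\<close>, where \<open>n - k\<close> is truncated, the factor \<open>gauss_rec q n k\<close> vanishes.
\<close>

fun gauss_rec :: "nat \<Rightarrow> nat \<Rightarrow> nat \<Rightarrow> nat"
  where
    "gauss_rec q n 0 = 1"
  | "gauss_rec q 0 (Suc k) = 0"
  | "gauss_rec q (Suc n) (Suc k) = gauss_rec q n (Suc k) + q ^ (n - k) * gauss_rec q n k"

context finite_vectorspace
begin

text \<open>The recursion of \<open>gauss_rec\<close> mirrors the division along a hyperplane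
  \<open>H\<close>: subspaces inside \<open>H\<close> give the first summand, and each
  \<open>k\<close>-dimensional subspace of \<open>H\<close> has \<open>q ^ (n - k)\<close>
  extensions leaving \<open>H\<close>.\<close>

lemma card_grassmannian:
  assumes "subspace K S V" "card S = q ^ n"
  shows "card (grassmannian S k) = gauss_rec q n k"
  using assms
proof (induction q\<equiv>"order K" n k arbitrary: S rule: gauss_rec.induct)
  case (1 n)
  then show ?case
    by (simp add: grassmannian_0)
next
  case (2 k)
  have "card T \<noteq> q ^ Suc k" if "T \<subseteq> S" for T
    using card_mono[OF subspace_finite[OF 2(1)] that] 2(2) power_order_le_iff[of "Suc k" 0] by auto
  then have "grassmannian S (Suc k) = {}"
    by (auto simp: grassmannian_def)
  then show ?case
    by simp
next
  case (3 n k)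
  note S = 3(3,4)
  have "{\<zero>\<^bsub>V\<^esub>} \<noteq> S"
    using S(2) order_ge_2 by auto
  then have "{\<zero>\<^bsub>V\<^esub>} \<subset> S"
    using subspace_zero[OF S(1)] by blast
  then obtain H where H: "subspace K H V" "H \<subset> S" "card S = q * card H"
    using hyperplane_exists[OF subspace_trivial S(1)] by metis
  have cardH: "card H = q ^ n"
    using H(3) S(2) order_ge_2 by simp
  let ?J = "\<Union>L'\<in>grassmannian H k. joins H L' S"
  have fin: "finite ?J"
    using finite_grassmannian[OF H(1)] finite_joins by blast
  have disj: "grassmannian H (Suc k) \<inter> ?J = {}"
  proof (rule ccontr)
    assume "grassmannian H (Suc k) \<inter> ?J \<noteq> {}"
    then obtain L L' where L: "L \<subseteq> H" "L \<in> joins H L' S"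
      by (auto simp: grassmannian_def)
    \<comment> \<open>A join \<open>L\<close> contained in \<open>H\<close> would give
      \<open>H + L = H\<close> instead of \<open>S\<close>.\<close>
    then have "S \<subseteq> H"
      using set_add_least[OF H(1) order_refl L(1)] joins_memD(5)[OF H(1) L(2)] by simp
    then show False
      using H(2) by blast
  qed
  have each: "card (joins H L' S) = q ^ (n - k)" if L': "L' \<in> grassmannian H k" for L'
  proof -
    have L: "subspace K L' V" "L' \<subseteq> H" "card L' = q ^ k"
      using L' by (auto simp: grassmannian_def)
    \<comment> \<open>This makes the subtraction in \<open>n - k\<close> a genuine one, so that
      \<open>n - k\<close> is the codimension of \<open>L'\<close> in \<open>H\<close>.\<close>
    have "k \<le> n"
      using card_mono[OF subspace_finite[OF H(1)] L(2)] L(3) cardH by simp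
    then have "card H = q ^ (n - k) * card L'"
      by (simp add: cardH L(3) power_add[symmetric])
    then show ?thesis
      using card_joins[OF H(1) S(1) L(1,2), of 1 "n - k"] H(2,3) by auto
  qed
  have "card ?J = (\<Sum>L'\<in>grassmannian H k. card (joins H L' S))"
  proof (rule card_UN_disjoint)
    show "\<forall>L1\<in>grassmannian H k. \<forall>L2\<in>grassmannian H k. L1 \<noteq> L2 \<longrightarrow> joins H L1 S \<inter> joins H L2 S = {}"
      by (auto simp: joins_def)
  qed (auto simp: finite_joins finite_grassmannian[OF H(1)])
  also have "\<dots> = q ^ (n - k) * gauss_rec q n k"
    using each 3(2)[OF H(1) cardH] by simp
  finally have cardJ: "card ?J = q ^ (n - k) * gauss_rec q n k" .
  show ?case
    unfolding grassmannian_hyperplane[OF S(1) H]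
    using card_Un_disjoint[OF finite_grassmannian[OF H(1)] fin disj] cardJ 3(1)[OF H(1) cardH]
    by simp
qed

end

section \<open>Dimension and cardinality\<close>

text \<open>Vectors correspond to their coordinates. Extensional functions on \<open>A\<close> are
  used so that the coordinate function is unique.\<close>

lemma (in vectorspace) bij_betw_lincomb_basis:
  assumes A: "finite A" "basis A"
  shows "bij_betw (\<lambda>a. lincomb a A) (A \<rightarrow>\<^sub>E carrier K) (carrier V)"
proof (rule bij_betwI')
  have AV: "A \<subseteq> carrier V"
    using A(2) by (simp add: basis_def)
  have closed: "lincomb a A \<in> carrier V" if "a \<in> A \<rightarrow>\<^sub>E carrier K" for a
    using lincomb_closed[OF AV, of a] that by (auto simp: PiE_def)
  then show "\<And>a. a \<in> A \<rightarrow>\<^sub>E carrier K \<Longrightarrow> lincomb a A \<in> carrier V" .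
  show "\<And>a b. a \<in> A \<rightarrow>\<^sub>E carrier K \<Longrightarrow> b \<in> A \<rightarrow>\<^sub>E carrier K \<Longrightarrow>
      lincomb a A = lincomb b A \<longleftrightarrow> a = b"
    using basis_criterion[OF A(1) AV] A(2) closed by metis
  show "\<And>x. x \<in> carrier V \<Longrightarrow> \<exists>a\<in>A \<rightarrow>\<^sub>E carrier K. x = lincomb a A"
    using basis_criterion[OF A(1) AV] A(2) by metis
qed

text \<open>Allows passing from a finite-dimensional space over a finite field to the locale
  \<open>finite_vectorspace\<close>.\<close>

lemma (in vectorspace) finite_carrier:
  assumes "fin_dim" "finite (carrier K)"
  shows "finite (carrier V)"
proof -
  obtain A where A: "finite A" "basis A"
    using finite_basis_exists[OF assms(1)] by blast
  show ?thesis
    using bij_betw_finite[OF bij_betw_lincomb_basis[OF A]] A(1) assms(2) by (simp add: finite_PiE)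
qed

context finite_vectorspace
begin

lemma fin_dim_holds: "fin_dim"
  unfolding fin_dim_def using finite_vectors in_own_span[of "carrier V"] span_is_subset2[of "carrier V"]
  by blast

lemma card_carrier: "card (carrier V) = q ^ dim"
proof -
  obtain A where A: "finite A" "basis A"
    using finite_basis_exists[OF fin_dim_holds] by blast
  have "card (carrier V) = card (A \<rightarrow>\<^sub>E carrier K)"
    by (rule bij_betw_same_card[OF bij_betw_lincomb_basis[OF A], symmetric])
  also have "\<dots> = q ^ card A"
    by (simp add: card_PiE[OF A(1)] order_def)
  finally show ?thesis
    using dim_basis[OF A] by simp
qed

lemma subspace_finite_vectorspace:
  assumes "subspace K S V"
  shows "finite_vectorspace K (V\<lparr>carrier := S\<rparr>)"
  using subspace_is_vs[OF assms] finite_scalars subspace_finite[OF assms]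
  by (simp add: finite_vectorspace_def finite_vectorspace_axioms_def)

text \<open>Besides translating dimension into size, this provides the exponent for any subspace
  whose size is not yet known to be a power of \<open>q\<close>.\<close>

lemma card_subspace:
  assumes "subspace K S V"
  shows "card S = q ^ vectorspace.dim K (V\<lparr>carrier := S\<rparr>)"
  using finite_vectorspace.card_carrier[OF subspace_finite_vectorspace[OF assms]] by simp

lemma subspaces_of_dim_eq: "subspaces_of_dim K V k = grassmannian (carrier V) k"
proof -
  have "vectorspace.fin_dim K (V\<lparr>carrier := S\<rparr>)" if "subspace K S V" for S
    by (rule finite_vectorspace.fin_dim_holds[OF subspace_finite_vectorspace[OF that]])
  then show ?thesis
    using card_subspace subspace_subset
    by (auto simp: subspaces_of_dim_def grassmannian_def)
qed

lemma subspace_of_subspace_iff: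
  assumes S: "subspace K S V"
  shows "subspace K T (V\<lparr>carrier := S\<rparr>) \<longleftrightarrow> subspace K T V \<and> T \<subseteq> S"
proof -
  have "module K (V\<lparr>carrier := S\<rparr>)" "vectorspace K (V\<lparr>carrier := S\<rparr>)"
    using subspace_is_vs[OF S] by (auto simp: vectorspace_def)
  then show ?thesis
    using subspace_subset[OF S] vectorspace_axioms module_axioms
    by (auto simp: subspace_def submodule_def)
qed

lemma subspaces_of_dim_subspace:
  assumes S: "subspace K S V"
  shows "subspaces_of_dim K (V\<lparr>carrier := S\<rparr>) k = grassmannian S k"
proof -
  interpret S: finite_vectorspace K "V\<lparr>carrier := S\<rparr>"
    by (rule subspace_finite_vectorspace[OF S])
  show ?thesis
    unfolding S.subspaces_of_dim_eq
    by (auto simp: S.grassmannian_def grassmannian_def subspace_of_subspace_iff[OF S])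
qed

lemma card_subspaces_of_dim:
  "card (carrier V) = q ^ n \<Longrightarrow> card (subspaces_of_dim K V k) = gauss_rec q n k"
  by (simp add: subspaces_of_dim_eq card_grassmannian subspace_carrier)

text \<open>The coordinate space has \<open>q ^ a\<close> elements, and the number of subspaces of a
  given dimension depends on this size only.\<close>

lemma gaussian_binomial_eq: "gaussian_binomial K a b = gauss_rec q a b"
proof -
  have eq: "carrier (ring.func_space K {..<a}) = {..<a} \<rightarrow>\<^sub>E carrier K"
    by (simp add: func_space_def)
  interpret F: finite_vectorspace K "ring.func_space K {..<a}"
    using func_space_is_vs[of "{..<a}"] finite_scalars
    by (simp add: finite_vectorspace_def finite_vectorspace_axioms_def eq finite_PiE)
  have "card (carrier (ring.func_space K {..<a})) = q ^ a"
    unfolding eq by (simp add: card_PiE order_def)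
  then show ?thesis
    unfolding gaussian_binomial_def by (rule F.card_subspaces_of_dim)
qed

section \<open>Quotient spaces\<close>

lemma subspace_additive: "subspace K U V \<Longrightarrow> abelian_subgroup U V"
proof (rule abelian_subgroupI3)
  assume U: "subspace K U V"
  show "additive_subgroup U V"
  proof (rule additive_subgroup.intro, rule M.add.subgroupI)
    show "U \<subseteq> carrier V" "U \<noteq> {}"
      using subspace_subset[OF U] subspace_zero[OF U] by auto
  qed (simp_all add: subspace_neg[OF U] subspace_add[OF U])
qed (rule M.abelian_group_axioms)

lemma mem_coset_iff: "y \<in> U +>\<^bsub>V\<^esub> x \<longleftrightarrow> (\<exists>u\<in>U. y = u \<oplus>\<^bsub>V\<^esub> x)"
  by (auto simp: a_r_coset_def')

lemma coset_self: "subspace K U V \<Longrightarrow> x \<in> carrier V \<Longrightarrow> x \<in> U +>\<^bsub>V\<^esub> x"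
  using subspace_zero[of U] M.l_zero[of x] unfolding mem_coset_iff by metis

lemma coset_eq_iff:
  assumes U: "subspace K U V" and x: "x \<in> carrier V" "y \<in> carrier V"
  shows "U +>\<^bsub>V\<^esub> x = U +>\<^bsub>V\<^esub> y \<longleftrightarrow> y \<in> U +>\<^bsub>V\<^esub> x"
proof -
  interpret U: abelian_subgroup U V
    by (rule subspace_additive[OF U])
  show ?thesis
    using U.a_repr_independence'[OF _ x(1)] coset_self[OF U x(2)] by metis
qed

lemma coset_zero: "subspace K U V \<Longrightarrow> U +>\<^bsub>V\<^esub> \<zero>\<^bsub>V\<^esub> = U"
  using subspace_mem_carrier[of U] by (auto simp: a_r_coset_def')

lemma coset_add:
  assumes U: "subspace K U V" and x: "x \<in> carrier V" "y \<in> carrier V"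
  shows "(U +>\<^bsub>V\<^esub> x) <+>\<^bsub>V\<^esub> (U +>\<^bsub>V\<^esub> y) = U +>\<^bsub>V\<^esub> (x \<oplus>\<^bsub>V\<^esub> y)"
proof -
  interpret U: abelian_subgroup U V
    by (rule subspace_additive[OF U])
  show ?thesis
    by (rule U.a_rcos_sum[OF x])
qed

lemma quotient_carrier: "carrier (quotient_space V U) = (\<lambda>x. U +>\<^bsub>V\<^esub> x) ` carrier V"
  by (auto simp: quotient_space_def A_RCOSETS_def')

text \<open>A coset depends only on the addition, so the cosets formed inside \<open>W\<close> are
  the cosets in \<open>V\<close> of the elements of \<open>W\<close>.\<close>

lemma quotient_carrier_subspace:
  "carrier (quotient_space (V\<lparr>carrier := W\<rparr>) U) = (\<lambda>x. U +>\<^bsub>V\<^esub> x) ` W"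
  by (auto simp: quotient_space_def A_RCOSETS_def' a_r_coset_def')

lemma quotient_zero: "\<zero>\<^bsub>quotient_space V U\<^esub> = U"
  by (simp add: quotient_space_def)

lemma quotient_add:
  assumes "subspace K U V" "x \<in> carrier V" "y \<in> carrier V"
  shows "(U +>\<^bsub>V\<^esub> x) \<oplus>\<^bsub>quotient_space V U\<^esub> (U +>\<^bsub>V\<^esub> y) = U +>\<^bsub>V\<^esub> (x \<oplus>\<^bsub>V\<^esub> y)"
  using coset_add[OF assms] by (simp add: quotient_space_def)

text \<open>All \<open>y\<close> in the coset of \<open>x\<close> have multiples congruent to that
  of \<open>x\<close> modulo \<open>U\<close>, so the union defining \<open>smult\<close> ranges
  over copies of a single coset.\<close>

lemma quotient_smult:
  assumes U: "subspace K U V" and x: "x \<in> carrier V" and a: "a \<in> carrier K"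
  shows "a \<odot>\<^bsub>quotient_space V U\<^esub> (U +>\<^bsub>V\<^esub> x) = U +>\<^bsub>V\<^esub> (a \<odot>\<^bsub>V\<^esub> x)"
proof -
  have "U +>\<^bsub>V\<^esub> (a \<odot>\<^bsub>V\<^esub> y) = U +>\<^bsub>V\<^esub> (a \<odot>\<^bsub>V\<^esub> x)" if y: "y \<in> U +>\<^bsub>V\<^esub> x" for y
  proof -
    obtain u where u: "u \<in> U" "y = u \<oplus>\<^bsub>V\<^esub> x"
      using y by (auto simp: mem_coset_iff)
    have uV: "u \<in> carrier V"
      by (rule subspace_mem_carrier[OF U u(1)])
    have "a \<odot>\<^bsub>V\<^esub> y = a \<odot>\<^bsub>V\<^esub> u \<oplus>\<^bsub>V\<^esub> a \<odot>\<^bsub>V\<^esub> x"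
      unfolding u(2) using a uV x by (rule smult_r_distr)
    then have "a \<odot>\<^bsub>V\<^esub> y \<in> U +>\<^bsub>V\<^esub> (a \<odot>\<^bsub>V\<^esub> x)"
      using subspace_smult[OF U a u(1)] by (auto simp: mem_coset_iff)
    then show ?thesis
      using coset_eq_iff[OF U, of "a \<odot>\<^bsub>V\<^esub> x" "a \<odot>\<^bsub>V\<^esub> y"] a x uV u(2) by simp
  qed
  then have "(\<Union>y\<in>U +>\<^bsub>V\<^esub> x. U +>\<^bsub>V\<^esub> (a \<odot>\<^bsub>V\<^esub> y)) = (\<Union>y\<in>U +>\<^bsub>V\<^esub> x. U +>\<^bsub>V\<^esub> (a \<odot>\<^bsub>V\<^esub> x))"
    by (intro SUP_cong refl)
  also have "\<dots> = U +>\<^bsub>V\<^esub> (a \<odot>\<^bsub>V\<^esub> x)"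
    using coset_self[OF U x] by blast
  finally show ?thesis
    by (simp add: quotient_space_def)
qed

lemma quotient_finite_vectorspace:
  assumes U: "subspace K U V"
  shows "finite_vectorspace K (quotient_space V U)"
proof -
  have "vectorspace K (quotient_space V U)"
  \<comment> \<open>Cases 2, 4 and 8 involve the zero of the quotient, which is \<open>U\<close> and
    has to be recognised as the coset of zero. The other vector space laws are computed on
    representatives.\<close>
  proof (rule vs_criteria, goal_cases)
    case 1
    show ?case
      by (rule field_axioms)
  next
    case 2
    show ?case
      unfolding quotient_zero quotient_carrier using coset_zero[OF U] by (metis image_eqI M.zero_closed)
  next
    case 4
    have "(U +>\<^bsub>V\<^esub> x) \<oplus>\<^bsub>quotient_space V U\<^esub> (U +>\<^bsub>V\<^esub> (\<ominus>\<^bsub>V\<^esub> x)) = \<zero>\<^bsub>quotient_space V U\<^esub>"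
      if "x \<in> carrier V" for x
      using that by (simp add: quotient_add[OF U] quotient_zero M.r_neg coset_zero[OF U])
    then show ?case
      unfolding quotient_carrier by blast
  next
    case 8
    have "(U +>\<^bsub>V\<^esub> x) \<oplus>\<^bsub>quotient_space V U\<^esub> \<zero>\<^bsub>quotient_space V U\<^esub> = U +>\<^bsub>V\<^esub> x"
      if "x \<in> carrier V" for x
      using that quotient_add[OF U that, of "\<zero>\<^bsub>V\<^esub>"] by (simp add: quotient_zero coset_zero[OF U])
    then show ?case
      unfolding quotient_carrier by blast
  qed (auto simp: quotient_carrier quotient_add[OF U] quotient_smult[OF U] M.a_ac
      smult_assoc1 smult_l_distr smult_r_distr)
  then show ?thesis
    using finite_scalars finite_vectors
    by (simp add: finite_vectorspace_def finite_vectorspace_axioms_def quotient_carrier)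
qed

text \<open>Recovers \<open>W\<close> from its image in the quotient, which makes passing to the
  quotient injective on subspaces containing \<open>U\<close>.\<close>

lemma Union_cosets:
  assumes U: "subspace K U V" and W: "subspace K W V" and UW: "U \<subseteq> W"
  shows "(\<Union>x\<in>W. U +>\<^bsub>V\<^esub> x) = W"
proof
  show "(\<Union>x\<in>W. U +>\<^bsub>V\<^esub> x) \<subseteq> W"
    using subsetD[OF UW] subspace_add[OF W] by (auto simp: mem_coset_iff)
  show "W \<subseteq> (\<Union>x\<in>W. U +>\<^bsub>V\<^esub> x)"
    using coset_self[OF U] subspace_mem_carrier[OF W] by blast
qed

lemma card_coset:
  assumes U: "subspace K U V" and x: "x \<in> carrier V"
  shows "card (U +>\<^bsub>V\<^esub> x) = card U"
proof -
  have "U +>\<^bsub>V\<^esub> x = (\<lambda>u. u \<oplus>\<^bsub>V\<^esub> x) ` U"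
    by (auto simp: a_r_coset_def')
  moreover have "inj_on (\<lambda>u. u \<oplus>\<^bsub>V\<^esub> x) U"
    using x subspace_mem_carrier[OF U] by (auto intro!: inj_onI)
  ultimately show ?thesis
    by (simp add: card_image)
qed

lemma card_cosets:
  assumes U: "subspace K U V" and W: "subspace K W V" and UW: "U \<subseteq> W"
  shows "card ((\<lambda>x. U +>\<^bsub>V\<^esub> x) ` W) * card U = card W"
proof -
  let ?Q = "(\<lambda>x. U +>\<^bsub>V\<^esub> x) ` W"
  have "card U * card ?Q = card (\<Union>?Q)"
  proof (rule card_partition)
    show "finite ?Q" "finite (\<Union>?Q)"
      using subspace_finite[OF W] Union_cosets[OF assms] by auto
    show "card c = card U" if "c \<in> ?Q" for c
      using that card_coset[OF U] subspace_mem_carrier[OF W] by auto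
    show "c1 \<inter> c2 = {}" if c: "c1 \<in> ?Q" "c2 \<in> ?Q" "c1 \<noteq> c2" for c1 c2
    proof (rule ccontr)
      assume "c1 \<inter> c2 \<noteq> {}"
      then obtain z where z: "z \<in> c1" "z \<in> c2"
        by blast
      obtain x y where xy: "x \<in> W" "c1 = U +>\<^bsub>V\<^esub> x" "y \<in> W" "c2 = U +>\<^bsub>V\<^esub> y"
        using c by auto
      have "z \<in> W"
        using z(1) xy Union_cosets[OF assms] by blast
      then have "c1 = U +>\<^bsub>V\<^esub> z" "c2 = U +>\<^bsub>V\<^esub> z"
        using z xy coset_eq_iff[OF U] subspace_mem_carrier[OF W] by simp_all
      then show False
        using c(3) by simp
    qed
  qed
  then show ?thesis
    by (simp add: Union_cosets[OF assms] mult.commute)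
qed

lemma subspace_cosets:
  assumes U: "subspace K U V" and W: "subspace K W V" and UW: "U \<subseteq> W"
  shows "subspace K ((\<lambda>x. U +>\<^bsub>V\<^esub> x) ` W) (quotient_space V U)"
proof -
  interpret Q: finite_vectorspace K "quotient_space V U"
    by (rule quotient_finite_vectorspace[OF U])
  note car = subspace_mem_carrier[OF W]
  show ?thesis
  proof (rule Q.subspaceI)
    show "(\<lambda>x. U +>\<^bsub>V\<^esub> x) ` W \<subseteq> carrier (quotient_space V U)"
      unfolding quotient_carrier using car by blast
    show "\<zero>\<^bsub>quotient_space V U\<^esub> \<in> (\<lambda>x. U +>\<^bsub>V\<^esub> x) ` W"
      unfolding quotient_zero using coset_zero[OF U] subspace_zero[OF W] by (metis image_eqI)
    show "X \<oplus>\<^bsub>quotient_space V U\<^esub> Y \<in> (\<lambda>x. U +>\<^bsub>V\<^esub> x) ` W"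
      if "X \<in> (\<lambda>x. U +>\<^bsub>V\<^esub> x) ` W" "Y \<in> (\<lambda>x. U +>\<^bsub>V\<^esub> x) ` W" for X Y
      using that car subspace_add[OF W] by (auto simp: quotient_add[OF U])
    show "a \<odot>\<^bsub>quotient_space V U\<^esub> X \<in> (\<lambda>x. U +>\<^bsub>V\<^esub> x) ` W"
      if "a \<in> carrier K" "X \<in> (\<lambda>x. U +>\<^bsub>V\<^esub> x) ` W" for a X
      using that car subspace_smult[OF W] by (auto simp: quotient_smult[OF U])
  qed
qed

text \<open>The surjective half of the correspondence theorem, with \<open>W\<close> the preimage of
  \<open>T\<close> under the projection.\<close>

lemma subspace_of_quotientE:
  assumes U: "subspace K U V" and T: "subspace K T (quotient_space V U)"
  obtains W where "subspace K W V" "U \<subseteq> W" "T = (\<lambda>x. U +>\<^bsub>V\<^esub> x) ` W"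
proof -
  interpret Q: finite_vectorspace K "quotient_space V U"
    by (rule quotient_finite_vectorspace[OF U])
  define W where "W = {x \<in> carrier V. U +>\<^bsub>V\<^esub> x \<in> T}"
  have "subspace K W V"
  proof (rule subspaceI)
    show "W \<subseteq> carrier V"
      by (auto simp: W_def)
    show "\<zero>\<^bsub>V\<^esub> \<in> W"
      using Q.subspace_zero[OF T] by (simp add: W_def coset_zero[OF U] quotient_zero)
    show "x \<oplus>\<^bsub>V\<^esub> y \<in> W" if "x \<in> W" "y \<in> W" for x y
      using that Q.subspace_add[OF T, of "U +>\<^bsub>V\<^esub> x" "U +>\<^bsub>V\<^esub> y"]
      by (simp add: W_def quotient_add[OF U])
    show "a \<odot>\<^bsub>V\<^esub> x \<in> W" if "a \<in> carrier K" "x \<in> W" for a x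
      using that Q.subspace_smult[OF T, of a "U +>\<^bsub>V\<^esub> x"]
      by (simp add: W_def quotient_smult[OF U])
  qed
  moreover have "U \<subseteq> W"
  proof
    fix u assume u: "u \<in> U"
    have uV: "u \<in> carrier V"
      by (rule subspace_mem_carrier[OF U u])
    have "u \<in> U +>\<^bsub>V\<^esub> \<zero>\<^bsub>V\<^esub>"
      using u coset_zero[OF U] by simp
    then have "U +>\<^bsub>V\<^esub> u = U"
      using coset_eq_iff[OF U M.zero_closed uV] coset_zero[OF U] by simp
    then show "u \<in> W"
      using uV Q.subspace_zero[OF T] by (simp add: W_def quotient_zero)
  qed
  moreover have "T = (\<lambda>x. U +>\<^bsub>V\<^esub> x) ` W"
    using Q.subspace_subset[OF T] unfolding W_def quotient_carrier by blast
  ultimately show thesis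
    by (rule that)
qed

text \<open>By the correspondence theorem the sets \<open>K2\<close> in the definition of
  \<open>covering_join_sets\<close> are in bijection with the \<open>s\<close>-dimensional subspaces
  of the quotient, whose dimension is \<open>n\<close>.\<close>

lemma card_quotient_subspaces:
  assumes U: "subspace K U V" and card: "card (carrier V) = q ^ n * card U"
  shows "card {W. subspace K W V \<and> U \<subseteq> W
      \<and> carrier (quotient_space (V\<lparr>carrier := W\<rparr>) U) \<in> subspaces_of_dim K (quotient_space V U) s}
    = gauss_rec q n s" (is "card ?A = _")
proof -
  interpret Q: finite_vectorspace K "quotient_space V U"
    by (rule quotient_finite_vectorspace[OF U])
  let ?f = "\<lambda>W. carrier (quotient_space (V\<lparr>carrier := W\<rparr>) U)"
  have "bij_betw ?f ?A (subspaces_of_dim K (quotient_space V U) s)"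
    unfolding bij_betw_def
  proof
    show "inj_on ?f ?A"
    proof (rule inj_onI)
      fix W W' assume W: "W \<in> ?A" "W' \<in> ?A" "?f W = ?f W'"
      then have "\<Union>((\<lambda>x. U +>\<^bsub>V\<^esub> x) ` W) = \<Union>((\<lambda>x. U +>\<^bsub>V\<^esub> x) ` W')"
        by (simp add: quotient_carrier_subspace)
      then show "W = W'"
        using W Union_cosets[OF U] by simp
    qed
    show "?f ` ?A = subspaces_of_dim K (quotient_space V U) s"
    proof
      show "?f ` ?A \<subseteq> subspaces_of_dim K (quotient_space V U) s"
        by blast
      show "subspaces_of_dim K (quotient_space V U) s \<subseteq> ?f ` ?A"
      proof
        fix T assume T: "T \<in> subspaces_of_dim K (quotient_space V U) s"
        then have "subspace K T (quotient_space V U)"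
          by (simp add: subspaces_of_dim_def)
        then obtain W where "subspace K W V" "U \<subseteq> W" "T = (\<lambda>x. U +>\<^bsub>V\<^esub> x) ` W"
          by (rule subspace_of_quotientE[OF U])
        then show "T \<in> ?f ` ?A"
          using T by (auto simp: quotient_carrier_subspace)
      qed
    qed
  qed
  then have "card ?A = card (subspaces_of_dim K (quotient_space V U) s)"
    by (rule bij_betw_same_card)
  also have "\<dots> = gauss_rec q n s"
  proof (rule Q.card_subspaces_of_dim)
    show "card (carrier (quotient_space V U)) = q ^ n"
      using card_cosets[OF U subspace_carrier subspace_subset[OF U]] card subspace_card_pos[OF U]
      by (simp add: quotient_carrier)
  qed
  finally show ?thesis .
qed

text \<open>Replaces the condition on the quotient by one on the size of \<open>W\<close>, using
  that \<open>W\<close> consists of cosets of size \<open>card U\<close>.\<close>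

lemma coset_image_mem_subspaces_of_dim_iff:
  assumes U: "subspace K U V" and W: "subspace K W V" "U \<subseteq> W"
  shows "carrier (quotient_space (V\<lparr>carrier := W\<rparr>) U) \<in> subspaces_of_dim K (quotient_space V U) s
    \<longleftrightarrow> card W = q ^ s * card U"
proof -
  interpret Q: finite_vectorspace K "quotient_space V U"
    by (rule quotient_finite_vectorspace[OF U])
  have "carrier (quotient_space (V\<lparr>carrier := W\<rparr>) U) \<in> subspaces_of_dim K (quotient_space V U) s
    \<longleftrightarrow> card ((\<lambda>x. U +>\<^bsub>V\<^esub> x) ` W) = q ^ s"
    unfolding Q.subspaces_of_dim_eq Q.grassmannian_def quotient_carrier_subspace
    using subspace_cosets[OF U W] Q.subspace_subset[OF subspace_cosets[OF U W]] by simp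
  also have "\<dots> \<longleftrightarrow> card W = q ^ s * card U"
    using card_cosets[OF U W] subspace_card_pos[OF U] by (metis mult_cancel2 less_numeral_extra(3))
  finally show ?thesis .
qed

section \<open>Covering joins along a chain\<close>

text \<open>The summand consists of the \<open>L\<close> of dimension \<open>s + a + 1\<close> whose
  intersection dimension jumps from \<open>a\<close> to \<open>a + 1\<close> between
  \<open>U1\<close> and \<open>U2\<close>. Covering amounts to this jump, and the dimension of the
  quotient part then fixes that of \<open>L\<close>.\<close>

lemma mem_covering_join_sets_iff:
  assumes U1: "subspace K U1 V" and U2: "subspace K U2 V"
    and sub: "U1 \<subseteq> U2" and card: "card U2 = q * card U1"
  shows "L \<in> covering_join_sets K V U1 U2
      (subspaces_of_dim K (V\<lparr>carrier := U1\<rparr>) a) (subspaces_of_dim K (quotient_space V U2) s)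
    \<longleftrightarrow> subspace K L V \<and> card (U1 \<inter> L) = q ^ a \<and> card (U2 \<inter> L) = q ^ Suc a
      \<and> card L = q ^ (s + Suc a)" (is "?l \<longleftrightarrow> ?r")
proof -
  have "?l \<longleftrightarrow> (\<exists>K1 K2. K1 \<in> grassmannian U1 a \<and> subspace K K2 V \<and> U2 \<subseteq> K2
      \<and> carrier (quotient_space (V\<lparr>carrier := K2\<rparr>) U2) \<in> subspaces_of_dim K (quotient_space V U2) s
      \<and> subspace K L V \<and> U1 \<inter> L = K1 \<and> U2 <+>\<^bsub>V\<^esub> L = K2 \<and> U1 <+>\<^bsub>V\<^esub> L = U2 <+>\<^bsub>V\<^esub> L)"
    unfolding covering_join_sets_def covering_join_def covers_def subspaces_of_dim_subspace[OF U1]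
    by blast
  also have "\<dots> \<longleftrightarrow> (\<exists>K1 K2. K1 \<in> grassmannian U1 a \<and> subspace K K2 V \<and> U2 \<subseteq> K2
      \<and> card K2 = q ^ s * card U2
      \<and> subspace K L V \<and> U1 \<inter> L = K1 \<and> U2 <+>\<^bsub>V\<^esub> L = K2 \<and> U1 <+>\<^bsub>V\<^esub> L = U2 <+>\<^bsub>V\<^esub> L)"
    using coset_image_mem_subspaces_of_dim_iff[OF U2] by blast
  \<comment> \<open>The spaces \<open>K1\<close> and \<open>K2\<close> are determined by
    \<open>L\<close>, so both quantifiers disappear.\<close>
  also have "\<dots> \<longleftrightarrow> subspace K L V \<and> card (U1 \<inter> L) = q ^ a
      \<and> card (U2 <+>\<^bsub>V\<^esub> L) = q ^ s * card U2 \<and> U1 <+>\<^bsub>V\<^esub> L = U2 <+>\<^bsub>V\<^esub> L"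
    using subspace_inter[OF U1] subspace_set_add[OF U2] set_add_upper1[OF U2]
    unfolding grassmannian_def by blast
  also have "\<dots> \<longleftrightarrow> ?r"
  proof (cases "subspace K L V \<and> card (U1 \<inter> L) = q ^ a")
    case True
    then have L: "subspace K L V" and c1: "card (U1 \<inter> L) = q ^ a"
      by auto
    have pos: "0 < card U1" "0 < card U2" "0 < card L"
      using subspace_card_pos U1 U2 L by auto
    have e1: "card (U1 <+>\<^bsub>V\<^esub> L) * q ^ a = card U1 * card L"
      using card_set_add[OF U1 L] c1 by simp
    have e2: "card (U2 <+>\<^bsub>V\<^esub> L) * card (U2 \<inter> L) = card U2 * card L"
      by (rule card_set_add[OF U2 L])
    have mono: "U1 <+>\<^bsub>V\<^esub> L \<subseteq> U2 <+>\<^bsub>V\<^esub> L"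
      using sub unfolding set_add_def' by blast
    have s1: "subspace K (U1 <+>\<^bsub>V\<^esub> L) V" and s2: "subspace K (U2 <+>\<^bsub>V\<^esub> L) V"
      using subspace_set_add U1 U2 L by auto
    have spos: "0 < card (U2 <+>\<^bsub>V\<^esub> L)"
      by (rule subspace_card_pos[OF s2])
    have "U1 <+>\<^bsub>V\<^esub> L = U2 <+>\<^bsub>V\<^esub> L \<longleftrightarrow> card (U1 <+>\<^bsub>V\<^esub> L) = card (U2 <+>\<^bsub>V\<^esub> L)"
      using subspace_eqI_card[OF s1 mono s2] by auto
    \<comment> \<open>The factor \<open>q ^ Suc a\<close> makes the left side equal to
      \<open>card U2 * card L\<close>, which the product formula for \<open>U2\<close> also
      provides.\<close>
    also have "\<dots> \<longleftrightarrow> card (U1 <+>\<^bsub>V\<^esub> L) * q ^ Suc a = card (U2 <+>\<^bsub>V\<^esub> L) * q ^ Suc a"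
      using order_ge_2 by simp
    also have "\<dots> \<longleftrightarrow> card (U2 <+>\<^bsub>V\<^esub> L) * card (U2 \<inter> L) = card (U2 <+>\<^bsub>V\<^esub> L) * q ^ Suc a"
      using e1 e2 card by (simp add: mult_ac)
    also have "\<dots> \<longleftrightarrow> card (U2 \<inter> L) = q ^ Suc a"
      using spos by simp
    finally have i1: "U1 <+>\<^bsub>V\<^esub> L = U2 <+>\<^bsub>V\<^esub> L \<longleftrightarrow> card (U2 \<inter> L) = q ^ Suc a" .
    have i2: "card (U2 <+>\<^bsub>V\<^esub> L) = q ^ s * card U2 \<longleftrightarrow> card L = q ^ (s + Suc a)"
      if c2: "card (U2 \<inter> L) = q ^ Suc a"
    proof -
      have "card (U2 <+>\<^bsub>V\<^esub> L) = q ^ s * card U2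
          \<longleftrightarrow> card (U2 <+>\<^bsub>V\<^esub> L) * q ^ Suc a = q ^ s * card U2 * q ^ Suc a"
        using order_ge_2 by simp
      also have "\<dots> \<longleftrightarrow> card U2 * card L = card U2 * q ^ (s + Suc a)"
        unfolding e2[unfolded c2] by (simp add: power_add mult_ac)
      finally show ?thesis
        using pos by simp
    qed
    show ?thesis
      using True i1 i2 by blast
  qed blast
  finally show ?thesis .
qed

text \<open>Distinct pairs \<open>(K1, K2)\<close> contribute disjoint families of joins. All have
  the same size, since \<open>U1 / K1\<close> has dimension \<open>j - a\<close> and
  \<open>K2 / U1\<close> has dimension \<open>s + 1\<close>.\<close>

lemma card_covering_join_sets:
  assumes U1: "subspace K U1 V" and U2: "subspace K U2 V" and sub: "U1 \<subseteq> U2"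
    and card: "card U1 = q ^ j" "card U2 = q ^ Suc j" "card (carrier V) = q ^ (n + Suc j)"
    and a: "a \<le> j"
  shows "card (covering_join_sets K V U1 U2
      (subspaces_of_dim K (V\<lparr>carrier := U1\<rparr>) a) (subspaces_of_dim K (quotient_space V U2) s))
    = q ^ ((j - a) * Suc s) * gauss_rec q j a * gauss_rec q n s"
proof -
  let ?A = "{K2. subspace K K2 V \<and> U2 \<subseteq> K2
      \<and> carrier (quotient_space (V\<lparr>carrier := K2\<rparr>) U2) \<in> subspaces_of_dim K (quotient_space V U2) s}"
  let ?G = "grassmannian U1 a"
  have finA: "finite ?A"
  proof (rule finite_subset)
    show "?A \<subseteq> Pow (carrier V)"
      using subspace_subset by blast
    show "finite (Pow (carrier V))"
      using finite_vectors by simp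
  qed
  have finG: "finite ?G"
    by (rule finite_grassmannian[OF U1])
  have cj: "covering_join K V U1 U2 K1 K2 = joins U1 K1 K2" if "K2 \<in> ?A" for K1 K2
  proof -
    have K2: "subspace K K2 V" "U2 \<subseteq> K2"
      using that by auto
    \<comment> \<open>As \<open>U2 \<subseteq> K2\<close>, the single equation
      \<open>U1 + L = K2\<close> already forces \<open>U2 + L = K2\<close> and hence the covering
      condition.\<close>
    have "U2 <+>\<^bsub>V\<^esub> L = K2" if L: "subspace K L V" "U1 <+>\<^bsub>V\<^esub> L = K2" for L
    proof
      show "U2 <+>\<^bsub>V\<^esub> L \<subseteq> K2"
        using set_add_least[OF K2, of L] set_add_upper2[OF U1 L(1)] L(2) by blast
      show "K2 \<subseteq> U2 <+>\<^bsub>V\<^esub> L"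
        unfolding L(2)[symmetric] set_add_def' using sub by blast
    qed
    then show ?thesis
      unfolding covering_join_def covers_def joins_def by auto
  qed
  have "covering_join_sets K V U1 U2 (subspaces_of_dim K (V\<lparr>carrier := U1\<rparr>) a)
      (subspaces_of_dim K (quotient_space V U2) s) = (\<Union>p\<in>?G \<times> ?A. joins U1 (fst p) (snd p))"
  proof -
    have inner: "(\<Union>K2\<in>?A. covering_join K V U1 U2 K1 K2) = (\<Union>K2\<in>?A. joins U1 K1 K2)" for K1
      by (rule SUP_cong[OF refl cj])
    have pairs: "(\<Union>K1\<in>G. \<Union>K2\<in>A. F K1 K2) = (\<Union>p\<in>G \<times> A. F (fst p) (snd p))"
      for G A and F :: "'c set \<Rightarrow> 'c set \<Rightarrow> 'c set set"
      by force
    show ?thesis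
      unfolding covering_join_sets_def subspaces_of_dim_subspace[OF U1] inner by (rule pairs)
  qed
  moreover have "card (\<Union>p\<in>?G \<times> ?A. joins U1 (fst p) (snd p))
      = (\<Sum>p\<in>?G \<times> ?A. card (joins U1 (fst p) (snd p)))"
  proof (rule card_UN_disjoint)
    show "finite (?G \<times> ?A)"
      using finG finA by blast
    show "\<forall>p\<in>?G \<times> ?A. finite (joins U1 (fst p) (snd p))"
      by (simp add: finite_joins)
    show "\<forall>p\<in>?G \<times> ?A. \<forall>p'\<in>?G \<times> ?A. p \<noteq> p' \<longrightarrow>
        joins U1 (fst p) (snd p) \<inter> joins U1 (fst p') (snd p') = {}"
      by (auto simp: joins_def)
  qed
  moreover have "card (joins U1 (fst p) (snd p)) = q ^ ((j - a) * Suc s)" if p: "p \<in> ?G \<times> ?A" for p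
  proof -
    have K1: "subspace K (fst p) V" "fst p \<subseteq> U1" "card (fst p) = q ^ a"
      using p by (auto simp: grassmannian_def)
    have K2: "subspace K (snd p) V" "U2 \<subseteq> snd p"
      and K2q: "carrier (quotient_space (V\<lparr>carrier := snd p\<rparr>) U2)
        \<in> subspaces_of_dim K (quotient_space V U2) s"
      using p by auto
    have "card (snd p) = q ^ s * card U2"
      using coset_image_mem_subspaces_of_dim_iff[OF U2 K2] K2q by blast
    \<comment> \<open>The exponent grows by one because the quotient is taken by \<open>U2\<close>
      but the joins are formed with \<open>U1\<close>.\<close>
    then have "card (snd p) = q ^ Suc s * card U1"
      using card by simp
    moreover have "card U1 = q ^ (j - a) * card (fst p)"
      using card K1(3) a by (simp add: power_add[symmetric])
    ultimately show ?thesis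
      using card_joins[OF U1 K2(1) K1(1,2)] sub K2(2) by blast
  qed
  moreover have "card ?G = gauss_rec q j a"
    by (rule card_grassmannian[OF U1 card(1)])
  moreover have "card ?A = gauss_rec q n s"
    by (rule card_quotient_subspaces[OF U2]) (simp add: card power_add)
  ultimately show ?thesis
    by (simp add: card_cartesian_product)
qed

text \<open>The dimensions \<open>d i\<close> increase strictly over \<open>v\<close> steps and end
  at a value of at most \<open>v\<close>. Counting steps from the bottom gives
  \<open>i \<le> d i\<close>, and counting them from the top gives the reverse inequality.\<close>

lemma card_chain:
  assumes sub: "\<And>i. i \<le> v \<Longrightarrow> subspace K (U i) V"
    and less: "\<And>i. i < v \<Longrightarrow> U i \<subset> U (Suc i)"
    and card: "card (carrier V) = q ^ v" and i: "i \<le> v"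
  shows "card (U i) = q ^ i"
proof -
  define d where "d i = vectorspace.dim K (V\<lparr>carrier := U i\<rparr>)" for i
  have d: "card (U i) = q ^ d i" if "i \<le> v" for i
    unfolding d_def by (rule card_subspace[OF sub[OF that]])
  have step: "d i < d (Suc i)" if "i < v" for i
  proof -
    have "card (U i) < card (U (Suc i))"
      by (rule psubset_card_mono[OF subspace_finite[OF sub] less]) (use that in auto)
    then have "q ^ d i < q ^ d (Suc i)"
      using d[of i] d[of "Suc i"] that by simp
    then show ?thesis
      by (rule power_less_imp_less_exp[rotated]) (use order_ge_2 in simp)
  qed
  have lower: "i \<le> d i" if "i \<le> v" for i
    using that
  proof (induction i)
    case (Suc i)
    then show ?case
      using step[of i] by simp
  qed simp
  have upper: "d j + (i - j) \<le> d i" if "j \<le> i" "i \<le> v" for i j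
    using that
  proof (induction i rule: dec_induct)
    case (step n)
    then show ?case
      using \<open>\<And>i. i < v \<Longrightarrow> d i < d (Suc i)\<close>[of n] by simp
  qed simp
  have "d v \<le> v"
    using d[of v] card_mono[OF finite_vectors subspace_subset[OF sub[of v]]] card by simp
  then have "d i = i"
    using lower[OF i] upper[OF i order_refl] i by simp
  then show ?thesis
    using d[OF i] by simp
qed

text \<open>By the product formula, enlarging \<open>U1\<close> by one dimension multiplies the
  product of the sizes of sum and intersection by \<open>q\<close>. The sum does not shrink, so the
  intersection grows by at most this factor.\<close>

lemma card_inter_hyperplane_le:
  assumes U1: "subspace K U1 V" and U2: "subspace K U2 V" and L: "subspace K L V"
    and sub: "U1 \<subseteq> U2" and card: "card U2 = q * card U1"
  shows "card (U2 \<inter> L) \<le> q * card (U1 \<inter> L)"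
proof -
  let ?W = "U1 <+>\<^bsub>V\<^esub> L"
  have "?W \<subseteq> U2 <+>\<^bsub>V\<^esub> L"
    using sub unfolding set_add_def' by blast
  then have "card ?W \<le> card (U2 <+>\<^bsub>V\<^esub> L)"
    by (rule card_mono[OF subspace_finite[OF subspace_set_add[OF U2 L]]])
  then have "card ?W * card (U2 \<inter> L) \<le> card (U2 <+>\<^bsub>V\<^esub> L) * card (U2 \<inter> L)"
    by (rule mult_right_mono) simp
  also have "\<dots> = card ?W * (q * card (U1 \<inter> L))"
    using card_set_add[OF U1 L] card_set_add[OF U2 L] card by (simp add: mult_ac)
  finally show ?thesis
    using subspace_card_pos[OF subspace_set_add[OF U1 L]] by simp
qed

text \<open>The first index at which the intersection dimension \<open>f\<close> reaches
  \<open>k - s\<close> is the upper end of the jump, since \<open>f\<close> grows by at most one per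
  step. The bounds on \<open>j\<close> come from \<open>f j \<le> j\<close> and from
  \<open>U (Suc j) + L\<close> fitting into \<open>V\<close>.\<close>

lemma chain_jump:
  assumes sub: "\<And>i. i \<le> v \<Longrightarrow> subspace K (U i) V"
    and mono: "\<And>i. i < v \<Longrightarrow> U i \<subseteq> U (Suc i)"
    and card: "\<And>i. i \<le> v \<Longrightarrow> card (U i) = q ^ i" and v: "card (carrier V) = q ^ v"
    and L: "subspace K L V" "card L = q ^ k" and s: "s < k"
  obtains j where "k - s - 1 \<le> j" "j + 1 + s \<le> v"
    "card (U j \<inter> L) = q ^ (k - s - 1)" "card (U (Suc j) \<inter> L) = q ^ (k - s)"
proof -
  define f where "f i = vectorspace.dim K (V\<lparr>carrier := U i \<inter> L\<rparr>)" for i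
  have f: "card (U i \<inter> L) = q ^ f i" if "i \<le> v" for i
    unfolding f_def by (rule card_subspace[OF subspace_inter[OF sub[OF that] L(1)]])
  have f_le: "f i \<le> i" if "i \<le> v" for i
    using card_mono[OF subspace_finite[OF sub[OF that]], of "U i \<inter> L"] f[OF that] card[OF that] by simp
  have "U v = carrier V"
    using subspace_eqI_card[OF sub[of v] subspace_subset[OF sub[of v]] subspace_carrier] card[of v] v
    by simp
  then have "U v \<inter> L = L"
    using subspace_subset[OF L(1)] by blast
  then have fv: "f v = k"
    using f[of v] L(2) by simp
  define m where "m = (LEAST i. i \<le> v \<and> k - s \<le> f i)"
  have m: "m \<le> v \<and> k - s \<le> f m"
    unfolding m_def by (rule LeastI[of _ v]) (simp add: fv)
  \<comment> \<open>At index zero the intersection has dimension zero, which is less than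
    \<open>k - s\<close>; so the least index has a predecessor.\<close>
  have "m \<noteq> 0"
    using m f_le[of 0] s by (metis less_le_trans not_less_zero zero_less_diff le0)
  then obtain j where j: "m = Suc j"
    using not0_implies_Suc by blast
  have jv: "Suc j \<le> v"
    using m j by simp
  have fj: "f j < k - s"
    using not_less_Least[of j "\<lambda>i. i \<le> v \<and> k - s \<le> f i"] jv j unfolding m_def by simp
  have "card (U (Suc j) \<inter> L) \<le> q * card (U j \<inter> L)"
    by (rule card_inter_hyperplane_le) (use sub L mono card jv in auto)
  then have "q ^ f (Suc j) \<le> q ^ Suc (f j)"
    using f[of j] f[of "Suc j"] jv by simp
  then have "f (Suc j) \<le> Suc (f j)"
    by (simp only: power_order_le_iff)
  then have f_eq: "f j = k - s - 1" "f (Suc j) = k - s"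
    using fj m j by auto
  \<comment> \<open>The sum of \<open>U (Suc j)\<close> and \<open>L\<close> has dimension
    \<open>j + 1 + k - (k - s)\<close>, which is at most \<open>v\<close>.\<close>
  have "q ^ (Suc j + k) = card (U (Suc j) <+>\<^bsub>V\<^esub> L) * q ^ (k - s)"
    using card_set_add[OF sub[OF jv] L(1)] f[OF jv] f_eq(2) card[OF jv] L(2) by (simp only: power_add)
  also have "\<dots> \<le> q ^ v * q ^ (k - s)"
    using card_mono[OF finite_vectors subspace_subset[OF subspace_set_add[OF sub[OF jv] L(1)]]] v by simp
  also have "\<dots> = q ^ (v + (k - s))"
    by (simp only: power_add)
  finally have "Suc j + k \<le> v + (k - s)"
    by (simp only: power_order_le_iff)
  then have "j + 1 + s \<le> v"
    using s by simp
  moreover have "k - s - 1 \<le> j"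
    using f_le[of j] f_eq(1) jv by simp
  ultimately show thesis
    using that f[of j] f[of "Suc j"] f_eq jv by simp
qed

text \<open>The substitution \<open>j = v - s - i - 1\<close> identifies the \<open>i\<close>-th
  summand with a jump between \<open>U j\<close> and \<open>U (Suc j)\<close>. Existence of a jump
  gives the union, its uniqueness gives disjointness, and adding the sizes gives the
  identity.\<close>

lemma subspaces_of_dim_covering_join_sets:
  fixes U :: "nat \<Rightarrow> 'c set" and v k s :: nat
  defines "J \<equiv> \<lambda>i. covering_join_sets K V (U (v - s - i - 1)) (U (v - s - i))
        (subspaces_of_dim K (V\<lparr>carrier := U (v - s - i - 1)\<rparr>) (k - s - 1))
        (subspaces_of_dim K (quotient_space V (U (v - s - i))) s)"
  assumes sub: "\<And>i. i \<le> v \<Longrightarrow> subspace K (U i) V"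
    and less: "\<And>i. i < v \<Longrightarrow> U i \<subset> U (Suc i)"
    and v: "card (carrier V) = q ^ v" and k: "k \<le> v" and s: "s < k"
  shows "subspaces_of_dim K V k = (\<Union>i\<in>{0..v - k}. J i)"
    and "disjoint_family_on J {0..v - k}"
    and "gaussian_binomial K v k = (\<Sum>i=0..v - k. q ^ ((v - k - i) * (s + 1))
        * gaussian_binomial K (v - s - i - 1) (k - s - 1) * gaussian_binomial K (s + i) s)"
proof -
  have card: "card (U i) = q ^ i" if "i \<le> v" for i
    using card_chain[of v U] sub less v that by blast
  \<comment> \<open>The truncated differences are resolved once and for all: \<open>s < k\<close>
    and \<open>i \<le> v - k\<close> keep \<open>v - s - i\<close> positive. The quotient by
    \<open>U (Suc j)\<close> has dimension \<open>s + i\<close>, and \<open>v - k - i\<close> is the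
    codimension of \<open>K1\<close> in \<open>U j\<close>.\<close>
  have J_eq: "\<exists>j<v. v - s - i = Suc j \<and> J i = covering_join_sets K V (U j) (U (Suc j))
        (subspaces_of_dim K (V\<lparr>carrier := U j\<rparr>) (k - s - 1))
        (subspaces_of_dim K (quotient_space V (U (Suc j))) s)
      \<and> v = (s + i) + Suc j \<and> k - s - 1 \<le> j \<and> j - (k - s - 1) = v - k - i"
    if i: "i \<le> v - k" for i
  proof -
    obtain j where j: "v - s - i = Suc j"
      using i k s by (cases "v - s - i") auto
    then have "j < v" "v = (s + i) + Suc j" "k - s - 1 \<le> j" "j - (k - s - 1) = v - k - i"
      using i k s by auto
    moreover have "J i = covering_join_sets K V (U j) (U (Suc j))
        (subspaces_of_dim K (V\<lparr>carrier := U j\<rparr>) (k - s - 1))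
        (subspaces_of_dim K (quotient_space V (U (Suc j))) s)"
      by (simp only: J_def j diff_Suc_1)
    ultimately show ?thesis
      using j by blast
  qed
  have link: "subspace K (U j) V" "subspace K (U (Suc j)) V" "U j \<subseteq> U (Suc j)"
    "card (U j) = q ^ j" "card (U (Suc j)) = q ^ Suc j" if "j < v" for j
    using sub[of j] sub[of "Suc j"] less[of j] card[of j] card[of "Suc j"] that by auto
  have J_iff: "L \<in> J i \<longleftrightarrow> subspace K L V \<and> card (U (v - s - i - 1) \<inter> L) = q ^ (k - s - 1)
      \<and> card (U (v - s - i) \<inter> L) = q ^ (k - s) \<and> card L = q ^ k" if i: "i \<le> v - k" for L i
  proof -
    obtain j where j: "j < v" "v - s - i = Suc j" and J: "J i = covering_join_sets K V (U j) (U (Suc j))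
        (subspaces_of_dim K (V\<lparr>carrier := U j\<rparr>) (k - s - 1))
        (subspaces_of_dim K (quotient_space V (U (Suc j))) s)"
      using J_eq[OF i] by blast
    have "card (U (Suc j)) = q * card (U j)"
      using link(4,5)[OF j(1)] by simp
    moreover have "Suc (k - s - 1) = k - s" "s + (k - s) = k"
      using s by auto
    ultimately show ?thesis
      unfolding J j(2) diff_Suc_1
      using mem_covering_join_sets_iff[OF link(1-3)[OF j(1)], of L "k - s - 1" s] by simp
  qed
  show union: "subspaces_of_dim K V k = (\<Union>i\<in>{0..v - k}. J i)"
  proof
    show "subspaces_of_dim K V k \<subseteq> (\<Union>i\<in>{0..v - k}. J i)"
    proof
      fix L assume "L \<in> subspaces_of_dim K V k"
      then have L: "subspace K L V" "card L = q ^ k"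
        by (auto simp: subspaces_of_dim_eq grassmannian_def)
      obtain j where j: "k - s - 1 \<le> j" "j + 1 + s \<le> v"
        "card (U j \<inter> L) = q ^ (k - s - 1)" "card (U (Suc j) \<inter> L) = q ^ (k - s)"
        by (rule chain_jump[of v U L k s, OF sub _ card v L s]) (use less in auto)
      \<comment> \<open>Inverts \<open>j = v - s - i - 1\<close>; the lower bound on
        \<open>j\<close> becomes \<open>i \<le> v - k\<close>.\<close>
      define i where "i = v - s - j - 1"
      have i: "i \<le> v - k" "v - s - i = Suc j"
        using j(1,2) s k by (auto simp: i_def)
      have "L \<in> J i"
        unfolding J_iff[OF i(1)] i(2) diff_Suc_1 using L j(3,4) by blast
      then show "L \<in> (\<Union>i\<in>{0..v - k}. J i)"
        using i(1) by auto
    qed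
    show "(\<Union>i\<in>{0..v - k}. J i) \<subseteq> subspaces_of_dim K V k"
      using J_iff by (auto simp: subspaces_of_dim_eq grassmannian_def dest: subspace_mem_carrier)
  qed
  \<comment> \<open>For \<open>i < i'\<close> the upper space of the jump at \<open>i'\<close> lies
    in the lower space of the jump at \<open>i\<close>. A common \<open>L\<close> would meet the
    smaller space in dimension \<open>k - s\<close> but the larger one only in dimension
    \<open>k - s - 1\<close>.\<close>
  have less_disj: "J i \<inter> J i' = {}" if "i < i'" "i' \<le> v - k" for i i'
  proof (rule ccontr)
    assume "J i \<inter> J i' \<noteq> {}"
    then obtain L where L: "L \<in> J i" "L \<in> J i'"
      by blast
    have le: "i \<le> v - k" and jj: "v - s - i' \<le> v - s - i - 1" "v - s - i - 1 \<le> v"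
      using that by auto
    have "U (v - s - i') \<subseteq> U (v - s - i - 1)"
      using jj
    proof (induction rule: dec_induct)
      case (step n)
      then show ?case
        using less[of n] by force
    qed simp
    then have "card (U (v - s - i') \<inter> L) \<le> card (U (v - s - i - 1) \<inter> L)"
      using card_mono[of "U (v - s - i - 1) \<inter> L"] subspace_finite[OF sub[OF jj(2)]] by blast
    then have "q ^ (k - s) \<le> q ^ (k - s - 1)"
      using L J_iff[OF le] J_iff[OF that(2)] by metis
    then show False
      using s by simp
  qed
  show disj: "disjoint_family_on J {0..v - k}"
    unfolding disjoint_family_on_def
  proof (intro ballI impI)
    fix i i' assume "i \<in> {0..v - k}" "i' \<in> {0..v - k}" "i \<noteq> i'"
    then show "J i \<inter> J i' = {}"
      using less_disj[of i i'] less_disj[of i' i] by (cases "i < i'") auto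
  qed
  have cardJ: "card (J i) = q ^ ((v - k - i) * (s + 1))
      * gaussian_binomial K (v - s - i - 1) (k - s - 1) * gaussian_binomial K (s + i) s"
    if i: "i \<in> {0..v - k}" for i
  proof -
    obtain j where j: "j < v" "v - s - i = Suc j" and J: "J i = covering_join_sets K V (U j) (U (Suc j))
        (subspaces_of_dim K (V\<lparr>carrier := U j\<rparr>) (k - s - 1))
        (subspaces_of_dim K (quotient_space V (U (Suc j))) s)"
      and v_eq: "v = (s + i) + Suc j" and le: "k - s - 1 \<le> j" and d: "j - (k - s - 1) = v - k - i"
      using J_eq[of i] i by auto
    have "card (carrier V) = q ^ ((s + i) + Suc j)"
      unfolding v by (rule arg_cong[OF v_eq])
    then show ?thesis
      unfolding J j(2) diff_Suc_1 gaussian_binomial_eq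
      using card_covering_join_sets[OF link[OF j(1)] _ le, of "s + i" s] d by simp
  qed
  have "gaussian_binomial K v k = card (subspaces_of_dim K V k)"
    by (simp add: gaussian_binomial_eq card_subspaces_of_dim[OF v])
  also have "\<dots> = (\<Sum>i=0..v - k. card (J i))"
    unfolding union
  proof (rule card_UN_disjoint)
    show "\<forall>i\<in>{0..v - k}. finite (J i)"
      using finite_grassmannian[OF subspace_carrier, of k] union
      by (metis UN_upper finite_subset subspaces_of_dim_eq)
    show "\<forall>i\<in>{0..v - k}. \<forall>i'\<in>{0..v - k}. i \<noteq> i' \<longrightarrow> J i \<inter> J i' = {}"
      using disj by (simp add: disjoint_family_on_def)
  qed simp
  also have "\<dots> = (\<Sum>i=0..v - k. q ^ ((v - k - i) * (s + 1))
      * gaussian_binomial K (v - s - i - 1) (k - s - 1) * gaussian_binomial K (s + i) s)"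
    by (rule sum.cong[OF refl cardJ])
  finally show "gaussian_binomial K v k = (\<Sum>i=0..v - k. q ^ ((v - k - i) * (s + 1))
      * gaussian_binomial K (v - s - i - 1) (k - s - 1) * gaussian_binomial K (s + i) s)" .
qed

end

theorem theorem3p21:
  fixes K :: "('a, 'm) ring_scheme" and V :: "('a, 'c, 'd) module_scheme"
    and U :: "nat \<Rightarrow> 'c set" and q v k s :: nat
  assumes "vectorspace K V" and "finite (carrier K)" and "order K = q"
    and "vectorspace.fin_dim K V" and "vectorspace.dim K V = v"
    and "maximal_subspace_chain K V v U"
    and "k \<le> v" and "s < k"
  shows "subspaces_of_dim K V k =
      (\<Union>i\<in>{0..v - k}. covering_join_sets K V (U (v - s - i - 1)) (U (v - s - i))
        (subspaces_of_dim K (V\<lparr>carrier := U (v - s - i - 1)\<rparr>) (k - s - 1))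
        (subspaces_of_dim K (quotient_space V (U (v - s - i))) s))
    \<and> disjoint_family_on (\<lambda>i. covering_join_sets K V (U (v - s - i - 1)) (U (v - s - i))
        (subspaces_of_dim K (V\<lparr>carrier := U (v - s - i - 1)\<rparr>) (k - s - 1))
        (subspaces_of_dim K (quotient_space V (U (v - s - i))) s)) {0..v - k}
    \<and> gaussian_binomial K v k =
      (\<Sum>i=0..v - k. q ^ ((v - k - i) * (s + 1))
        * gaussian_binomial K (v - s - i - 1) (k - s - 1) * gaussian_binomial K (s + i) s)"
proof -
  interpret vectorspace K V
    by (rule assms(1))
  \<comment> \<open>Finiteness of the set of vectors comes from \<open>finite_carrier\<close>,
    available through the preceding interpretation.\<close>
  interpret finite_vectorspace K V
    by unfold_locales (use finite_carrier assms in auto)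
  have chain: "subset.chain {W. subspace K W V} (U ` {..v})"
    and less: "\<And>i. i < v \<Longrightarrow> U i \<subset> U (Suc i)"
    using assms(6) by (auto simp: maximal_subspace_chain_def subset.maxchain_def)
  have sub: "subspace K (U i) V" if "i \<le> v" for i
    using chain that by (auto simp: subset.chain_def)
  have v: "card (carrier V) = order K ^ v"
    using card_carrier assms(5) by simp
  show ?thesis
    using subspaces_of_dim_covering_join_sets[of v U k s, OF sub less v assms(7,8)] assms(3) by simp
qed

end
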